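(* Suppose that: (a) the transition kernel $\mathcal{T}(\cdot|x,u)$ is weakly continuous in $(x,u)$; (b) the channel $Q$ is continuous in total variation, i.e. $\|Q(\cdot|x_n)-Q(\cdot|x)\|_{TV}\to0$ whenever $x_n\to x$; (c) the stage-wise cost function $c:\mathbb{X}\times\mathbb{U}\to\mathbb{R}$ is non-negative, bounded and continuous on $\mathbb{X}\times\mathbb{U}$; (d) $\mathbb{U}$ is compact. Let $P_n\to P$ weakly in $\mathcal{P}(\mathbb{X})$ and, for each $n$, let $\gamma^*_{P_n}\in\Gamma$ be an optimal policy for prior $P_n$, i.e. $J_\beta(P_n,\mathcal{T},\gamma^*_{P_n})=J^*_\beta(P_n,\mathcal{T})$. Then $$|J_\beta(P,\mathcal{T},\gamma^*_{P_n})-J^*_\beta(P,\mathcal{T})|\to0.$$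
   Context: $\mathbb{X}\subset\mathbb{R}^n$, $\mathbb{Y}\subset\mathbb{R}^m$ and $\mathbb{U}$ (a subset of some Euclidean space) are Borel sets; $\mathcal{P}(\mathbb{X})$ is the set of Borel probability measures on $\mathbb{X}$. $Q(\cdot|x)$ (the channel) is a stochastic kernel from $\mathbb{X}$ to $\mathbb{Y}$ and $\mathcal{T}(\cdot|x,u)$ is a stochastic kernel from $\mathbb{X}\times\mathbb{U}$ to $\mathbb{X}$; weak continuity of $\mathcal{T}$ means $(x,u)\mapsto\int g(x_1)\mathcal{T}(dx_1|x,u)$ is continuous for every bounded continuous $g$. An admissible policy is a sequence $\gamma=\{\gamma_t\}_{t\ge0}$ of measurable control functions with $U_t=\gamma_t(I_t)\in\mathbb{U}$, where $I_0=\{Y_0\}$, $I_t=\{Y_0,\dots,Y_t,U_0,\dots,U_{t-1}\}$; $\Gamma$ is the set of admissible policies. Given an initial law (prior) $P\in\mathcal{P}(\mathbb{X})$ and $\gamma\in\Gamma$, the process evolves as $X_0\sim P$, $Y_t\sim Q(\cdot|X_t)$ and $X_{t+1}\sim\mathcal{T}(\cdot|X_t,U_t)$ (conditionally on the past); $E_P^{\gamma}$ is the corresponding expectation. For fixed $\beta\in(0,1)$, $$J_\beta(P,\mathcal{T},\gamma)=E_P^{\gamma}\Big[\sum_{t=0}^\infty\beta^tc(X_t,U_t)\Big],\qquad J_\beta^*(P,\mathcal{T})=\inf_{\gamma\in\Gamma}J_\beta(P,\mathcal{T},\gamma),$$ with $Q$ fixed. The total variation distance is $\|\mu-\nu\|_{TV}=2\sup_B|\mu(B)-\nu(B)|$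 over Borel sets $B$. *)

theory Defs
  imports "HOL-Probability.Probability"
begin

abbreviation borel_on :: "'a::topological_space set \<Rightarrow> 'a measure" where
  "borel_on S \<equiv> restrict_space borel S"

text \<open>Borel probability measures on \<open>S\<close> are the elements of
  \<open>space (prob_algebra (borel_on S))\<close>; a stochastic kernel from \<open>S\<close> to \<open>R\<close> is a measurable map
  \<open>borel_on S \<rightarrow>\<^sub>M prob_algebra (borel_on R)\<close>.  The test functions below are continuous for
  the subspace topology of \<open>S\<close>, and \<open>space (\<mu> n) = S\<close>.\<close>

definition weak_conv_on ::
    "'a::topological_space set \<Rightarrow> (nat \<Rightarrow> 'a measure) \<Rightarrow> 'a measure \<Rightarrow> bool" where
  "weak_conv_on S \<mu> \<nu> \<longleftrightarrow>
     (\<forall>g::'a \<Rightarrow> real. continuous_on S g \<and> bounded (g ` S) \<longrightarrow>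
        (\<lambda>n. \<integral>x. g x \<partial>\<mu> n) \<longlonglongrightarrow> (\<integral>x. g x \<partial>\<nu>))"

definition weakly_continuous_kernel ::
    "'z::topological_space set \<Rightarrow> 'a::topological_space set \<Rightarrow> ('z \<Rightarrow> 'a measure) \<Rightarrow> bool" where
  "weakly_continuous_kernel Z S K \<longleftrightarrow>
     (\<forall>g::'a \<Rightarrow> real. continuous_on S g \<and> bounded (g ` S) \<longrightarrow>
        continuous_on Z (\<lambda>z. \<integral>x. g x \<partial>K z))"

definition tv_dist :: "'a measure \<Rightarrow> 'a measure \<Rightarrow> real" where
  "tv_dist \<mu> \<nu> = 2 * (SUP B\<in>sets \<mu>. \<bar>measure \<mu> B - measure \<nu> B\<bar>)"

definition tv_continuous_kernel ::
    "'z::topological_space set \<Rightarrow> ('z \<Rightarrow> 'a measure) \<Rightarrow> bool" where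
  "tv_continuous_kernel Z K \<longleftrightarrow>
     (\<forall>xs x. (\<forall>n. xs n \<in> Z) \<and> x \<in> Z \<and> xs \<longlonglongrightarrow> x \<longrightarrow>
        (\<lambda>n. tv_dist (K (xs n)) (K x)) \<longlonglongrightarrow> 0)"

text \<open>A policy \<open>\<gamma>\<close> maps the time \<open>t\<close> and the information
  \<open>((Y\<^sub>0, \<dots>, Y\<^sub>t), (U\<^sub>0, \<dots>, U\<^sub>t\<^sub>-\<^sub>1))\<close> to the control \<open>U\<^sub>t\<close>.\<close>

type_synonym ('y, 'u) policy = "nat \<Rightarrow> (nat \<Rightarrow> 'y) \<times> (nat \<Rightarrow> 'u) \<Rightarrow> 'u"

definition admissible ::
    "'y::topological_space set \<Rightarrow> 'u::topological_space set \<Rightarrow> ('y, 'u) policy set" where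
  "admissible Y U =
     {\<gamma>. \<forall>t. \<gamma> t \<in> PiM {..t} (\<lambda>_. borel_on Y) \<Otimes>\<^sub>M PiM {..<t} (\<lambda>_. borel_on U) \<rightarrow>\<^sub>M borel_on U}"

text \<open>A trajectory is a sequence of triples \<open>(X\<^sub>t, Y\<^sub>t, U\<^sub>t)\<close>.\<close>

abbreviation stage_space ::
    "'x::topological_space set \<Rightarrow> 'y::topological_space set \<Rightarrow> 'u::topological_space set
      \<Rightarrow> ('x \<times> 'y \<times> 'u) measure" where
  "stage_space X Y U \<equiv> borel_on X \<Otimes>\<^sub>M (borel_on Y \<Otimes>\<^sub>M borel_on U)"

definition st :: "'x \<times> 'y \<times> 'u \<Rightarrow> 'x" where "st z = fst z"
definition obs :: "'x \<times> 'y \<times> 'u \<Rightarrow> 'y" where "obs z = fst (snd z)"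
definition act :: "'x \<times> 'y \<times> 'u \<Rightarrow> 'u" where "act z = snd (snd z)"

definition information :: "nat \<Rightarrow> (nat \<Rightarrow> 'x \<times> 'y \<times> 'u) \<Rightarrow> 'y \<Rightarrow> (nat \<Rightarrow> 'y) \<times> (nat \<Rightarrow> 'u)" where
  "information t h y = ((\<lambda>i\<in>{..t}. if i < t then obs (h i) else y), (\<lambda>i\<in>{..<t}. act (h i)))"

text \<open>Conditional law of \<open>(X\<^sub>t, Y\<^sub>t, U\<^sub>t)\<close> given the past \<open>h = (X\<^sub>i, Y\<^sub>i, U\<^sub>i)\<^sub>i\<^sub><\<^sub>t\<close>.\<close>

definition stage_kernel ::
    "'x::topological_space set \<Rightarrow> 'y::topological_space set \<Rightarrow> 'u::topological_space set
      \<Rightarrow> ('x \<Rightarrow> 'y measure) \<Rightarrow> 'x measure \<Rightarrow> ('x \<times> 'u \<Rightarrow> 'x measure) \<Rightarrow> ('y, 'u) policy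
      \<Rightarrow> nat \<Rightarrow> (nat \<Rightarrow> 'x \<times> 'y \<times> 'u) \<Rightarrow> ('x \<times> 'y \<times> 'u) measure" where
  "stage_kernel X Y U Q P T \<gamma> t h =
     (if t = 0 then P else T (st (h (t - 1)), act (h (t - 1)))) \<bind> (\<lambda>x.
       Q x \<bind> (\<lambda>y. return (stage_space X Y U) (x, y, \<gamma> t (information t h y))))"

text \<open>The law of the whole trajectory: the projective limit given by the Ionescu-Tulcea theorem.\<close>

definition trajectory_law ::
    "'x::topological_space set \<Rightarrow> 'y::topological_space set \<Rightarrow> 'u::topological_space set
      \<Rightarrow> ('x \<Rightarrow> 'y measure) \<Rightarrow> 'x measure \<Rightarrow> ('x \<times> 'u \<Rightarrow> 'x measure) \<Rightarrow> ('y, 'u) policy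
      \<Rightarrow> (nat \<Rightarrow> 'x \<times> 'y \<times> 'u) measure" where
  "trajectory_law X Y U Q P T \<gamma> =
     projective_family.lim UNIV
       (Ionescu_Tulcea.CI (stage_kernel X Y U Q P T \<gamma>) (\<lambda>_. stage_space X Y U))
       (\<lambda>_. stage_space X Y U)"

definition cost ::
    "'x::topological_space set \<Rightarrow> 'y::topological_space set \<Rightarrow> 'u::topological_space set
      \<Rightarrow> ('x \<Rightarrow> 'y measure) \<Rightarrow> ('x \<times> 'u \<Rightarrow> real) \<Rightarrow> real
      \<Rightarrow> 'x measure \<Rightarrow> ('x \<times> 'u \<Rightarrow> 'x measure) \<Rightarrow> ('y, 'u) policy \<Rightarrow> real" where
  "cost X Y U Q c \<beta> P T \<gamma> =
     (\<integral>\<omega>. (\<Sum>t. \<beta> ^ t * c (st (\<omega> t), act (\<omega> t))) \<partial>trajectory_law X Y U Q P T \<gamma>)"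

definition opt_cost ::
    "'x::topological_space set \<Rightarrow> 'y::topological_space set \<Rightarrow> 'u::topological_space set
      \<Rightarrow> ('x \<Rightarrow> 'y measure) \<Rightarrow> ('x \<times> 'u \<Rightarrow> real) \<Rightarrow> real
      \<Rightarrow> 'x measure \<Rightarrow> ('x \<times> 'u \<Rightarrow> 'x measure) \<Rightarrow> real" where
  "opt_cost X Y U Q c \<beta> P T = (INF \<gamma>\<in>admissible Y U. cost X Y U Q c \<beta> P T \<gamma>)"

lemma measurable_st [measurable]: "st \<in> A \<Otimes>\<^sub>M (B \<Otimes>\<^sub>M C) \<rightarrow>\<^sub>M A"
  and measurable_obs [measurable]: "obs \<in> A \<Otimes>\<^sub>M (B \<Otimes>\<^sub>M C) \<rightarrow>\<^sub>M B"
  and measurable_act [measurable]: "act \<in> A \<Otimes>\<^sub>M (B \<Otimes>\<^sub>M C) \<rightarrow>\<^sub>M C"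
  unfolding st_def[abs_def] obs_def[abs_def] act_def[abs_def] by measurable

lemma measurable_information:
  "(\<lambda>(h, y). information t h y) \<in>
     PiM {0..<t} (\<lambda>_. A \<Otimes>\<^sub>M (B \<Otimes>\<^sub>M C)) \<Otimes>\<^sub>M B \<rightarrow>\<^sub>M PiM {..t} (\<lambda>_. B) \<Otimes>\<^sub>M PiM {..<t} (\<lambda>_. C)"
proof -
  let ?H = "PiM {0..<t} (\<lambda>_. A \<Otimes>\<^sub>M (B \<Otimes>\<^sub>M C)) \<Otimes>\<^sub>M B"
  have h: "(\<lambda>p. fst p i) \<in> ?H \<rightarrow>\<^sub>M A \<Otimes>\<^sub>M (B \<Otimes>\<^sub>M C)" if "i < t" for i
    using that by (intro measurable_compose[OF measurable_fst measurable_component_singleton]) auto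
  have "(\<lambda>p. if i < t then obs (fst p i) else snd p) \<in> ?H \<rightarrow>\<^sub>M B" for i
    using measurable_compose[OF h measurable_obs] by (cases "i < t") auto
  moreover have "(\<lambda>p. act (fst p i)) \<in> ?H \<rightarrow>\<^sub>M C" if "i < t" for i
    using measurable_compose[OF h[OF that] measurable_act] .
  ultimately show ?thesis
    unfolding information_def split_beta'
    by (intro measurable_Pair measurable_restrict) auto
qed

lemma measurable_stage_kernel:
  assumes P: "P \<in> space (prob_algebra (borel_on X))"
    and T: "T \<in> borel_on X \<Otimes>\<^sub>M borel_on U \<rightarrow>\<^sub>M prob_algebra (borel_on X)"
    and Q: "Q \<in> borel_on X \<rightarrow>\<^sub>M prob_algebra (borel_on Y)"
    and \<gamma>: "\<gamma> \<in> admissible Y U"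
  shows "stage_kernel X Y U Q P T \<gamma> t \<in>
    PiM {0..<t} (\<lambda>_. stage_space X Y U) \<rightarrow>\<^sub>M prob_algebra (stage_space X Y U)"
proof -
  let ?H = "PiM {0..<t} (\<lambda>_. stage_space X Y U)"
  note T[measurable] Q[measurable]
  have [measurable]: "\<gamma> t \<in> PiM {..t} (\<lambda>_. borel_on Y) \<Otimes>\<^sub>M PiM {..<t} (\<lambda>_. borel_on U) \<rightarrow>\<^sub>M borel_on U"
    using \<gamma> by (simp add: admissible_def)
  have "(\<lambda>p. (fst (fst p), snd p)) \<in> (?H \<Otimes>\<^sub>M borel_on X) \<Otimes>\<^sub>M borel_on Y \<rightarrow>\<^sub>M ?H \<Otimes>\<^sub>M borel_on Y"
    by measurable
  from measurable_compose[OF this measurable_information]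
  have [measurable]: "(\<lambda>p. information t (fst (fst p)) (snd p)) \<in> (?H \<Otimes>\<^sub>M borel_on X) \<Otimes>\<^sub>M borel_on Y \<rightarrow>\<^sub>M
      PiM {..t} (\<lambda>_. borel_on Y) \<Otimes>\<^sub>M PiM {..<t} (\<lambda>_. borel_on U)"
    by simp
  have "(\<lambda>h. if t = 0 then P else T (st (h (t - 1)), act (h (t - 1)))) \<in> ?H \<rightarrow>\<^sub>M prob_algebra (borel_on X)"
  proof (cases "t = 0")
    case False
    then have [measurable]: "(\<lambda>h. h (t - 1)) \<in> ?H \<rightarrow>\<^sub>M stage_space X Y U"
      by (intro measurable_component_singleton) auto
    show ?thesis using False by simp
  qed (use P in simp)
  moreover have "(\<lambda>p. Q (snd p) \<bind> (\<lambda>y. return (stage_space X Y U)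
      (snd p, y, \<gamma> t (information t (fst p) y)))) \<in> ?H \<Otimes>\<^sub>M borel_on X \<rightarrow>\<^sub>M prob_algebra (stage_space X Y U)"
    by (rule measurable_bind_prob_space2[where N="borel_on Y"]) (simp_all add: split_beta')
  ultimately show ?thesis
    unfolding stage_kernel_def[abs_def]
    by (intro measurable_bind_prob_space2[where N="borel_on X"]) (simp_all add: split_beta')
qed

lemma Ionescu_Tulcea_stage_kernel:
  assumes "P \<in> space (prob_algebra (borel_on X))"
    and "T \<in> borel_on X \<Otimes>\<^sub>M borel_on U \<rightarrow>\<^sub>M prob_algebra (borel_on X)"
    and "Q \<in> borel_on X \<rightarrow>\<^sub>M prob_algebra (borel_on Y)"
    and "\<gamma> \<in> admissible Y U"
  shows "Ionescu_Tulcea (stage_kernel X Y U Q P T \<gamma>) (\<lambda>_. stage_space X Y U)"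
proof (rule Ionescu_Tulcea.intro)
  note K = measurable_stage_kernel[OF assms]
  show "stage_kernel X Y U Q P T \<gamma> t \<in>
      PiM {0..<t} (\<lambda>_. stage_space X Y U) \<rightarrow>\<^sub>M subprob_algebra (stage_space X Y U)" for t
    by (rule measurable_prob_algebraD[OF K])
  show "prob_space (stage_kernel X Y U Q P T \<gamma> t h)"
    if "h \<in> space (PiM {0..<t} (\<lambda>_. stage_space X Y U))" for t h
    using measurable_space[OF K that] by (simp add: space_prob_algebra)
qed

end

theory Submission
  imports Defs
begin

text \<open>The cost \<open>J\<^sub>\<beta>(P, \<T>, \<gamma>)\<close> depends continuously on \<open>P\<close>, uniformly over all policies \<open>\<gamma>\<close>; comparing
  \<open>\<gamma>\<^sub>n\<close> with an arbitrary policy under \<open>P\<^sub>n\<close> then gives the claim. Up to a uniformly small discounted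
  tail, \<open>J\<^sub>\<beta>(P, \<T>, \<gamma>)\<close> is the integral over \<open>P\<close> of a cost-to-go function of the initial state, and weak
  convergence is uniform over bounded equicontinuous families. The cost-to-go functions of all
  policies with \<open>k\<close> remaining stages form such a family, by induction on \<open>k\<close>: a change of the state
  changes the law of the observation little in total variation, whatever the measurable policy
  does with the observation, and the inner integral over \<open>\<T>(\<cdot>|x,u)\<close> is continuous in \<open>x\<close> uniformly in
  \<open>u \<in> U\<close> and in the integrand, by compactness of \<open>U\<close> and the induction hypothesis.\<close>

subsection \<open>Equicontinuous families and weak convergence\<close>

text \<open>The radius \<open>d\<close> may depend on the point \<open>x\<close>, but not on
  \<open>g\<close>. The non-strict bound \<open>\<le> e\<close> survives integration.\<close>

definition equicont_on :: "'a::metric_space set \<Rightarrow> ('a \<Rightarrow> real) set \<Rightarrow> bool" where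
  "equicont_on X F \<longleftrightarrow>
     (\<forall>x\<in>X. \<forall>e>0. \<exists>d>0. \<forall>g\<in>F. \<forall>x'\<in>X. dist x' x < d \<longrightarrow> \<bar>g x' - g x\<bar> \<le> e)"

text \<open>If no radius works at \<open>x\<close>, the radii \<open>1 / (n + 1)\<close> give points
  \<open>xs n\<close> tending to \<open>x\<close> at which some \<open>g\<close> in \<open>F\<close>
  violates the bound. The kernels will be used along sequences.\<close>

lemma equicont_on_sequentiallyI:
  assumes "\<And>xs x e. (\<And>n. xs n \<in> X) \<Longrightarrow> x \<in> X \<Longrightarrow> xs \<longlonglongrightarrow> x \<Longrightarrow> 0 < e \<Longrightarrow>
     \<forall>\<^sub>F n in sequentially. \<forall>g\<in>F. \<bar>g (xs n) - g x\<bar> \<le> e"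
  shows "equicont_on X F"
  unfolding equicont_on_def
proof (intro ballI allI impI, rule ccontr)
  fix x and e :: real assume x: "x \<in> X" and e: "0 < e"
    and "\<not> (\<exists>d>0. \<forall>g\<in>F. \<forall>x'\<in>X. dist x' x < d \<longrightarrow> \<bar>g x' - g x\<bar> \<le> e)"
  then have "\<forall>n. \<exists>x'\<in>X. dist x' x < inverse (real (Suc n)) \<and> (\<exists>g\<in>F. \<not> \<bar>g x' - g x\<bar> \<le> e)"
    by (meson inverse_positive_iff_positive of_nat_0_less_iff zero_less_Suc)
  then obtain xs where xs: "\<And>n. xs n \<in> X" "\<And>n. dist (xs n) x < inverse (real (Suc n))"
    and g: "\<And>n. \<exists>g\<in>F. \<not> \<bar>g (xs n) - g x\<bar> \<le> e"
    by metis
  have "(\<lambda>n. dist (xs n) x) \<longlonglongrightarrow> 0"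
    by (rule tendsto_sandwich[OF _ _ tendsto_const LIMSEQ_inverse_real_of_nat])
      (use xs(2) in \<open>auto intro!: always_eventually less_imp_le simp del: of_nat_Suc\<close>)
  then have "xs \<longlonglongrightarrow> x"
    by (rule tendsto_dist_iff[THEN iffD2])
  from eventually_happens[OF assms[OF xs(1) x this e]] g show False
    by auto
qed

lemma equicont_on_imp_continuous_on:
  assumes "equicont_on X F" "g \<in> F"
  shows "continuous_on X g"
  unfolding continuous_on_iff
proof (intro ballI allI impI)
  fix x and e :: real assume "x \<in> X" "0 < e"
  with assms(1) obtain d where "d > 0" "\<forall>g\<in>F. \<forall>x'\<in>X. dist x' x < d \<longrightarrow> \<bar>g x' - g x\<bar> \<le> e / 2"
    unfolding equicont_on_def by (meson half_gt_zero)
  with \<open>0 < e\<close> assms(2) show "\<exists>d>0. \<forall>x'\<in>X. dist x' x < d \<longrightarrow> dist (g x') (g x) < e"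
    by (force simp: dist_real_def)
qed

lemma prob_algebra_borel_onD:
  assumes "\<mu> \<in> space (prob_algebra (borel_on X))"
  shows "prob_space \<mu>" "sets \<mu> = sets (borel_on X)" "space \<mu> = X"
  using assms sets_eq_imp_space_eq[of \<mu> "borel_on X"]
  by (auto simp: space_prob_algebra space_restrict_space)

lemma (in prob_space) integrable_bounded:
  fixes f :: "'a \<Rightarrow> real"
  assumes "f \<in> borel_measurable M" "\<And>x. x \<in> space M \<Longrightarrow> \<bar>f x\<bar> \<le> B"
  shows "integrable M f"
  using assms by (intro integrable_const_bound[of _ B]) auto

lemma (in prob_space) abs_integral_le_bound:
  fixes f :: "'a \<Rightarrow> real"
  assumes "f \<in> borel_measurable M" "\<And>x. x \<in> space M \<Longrightarrow> \<bar>f x\<bar> \<le> B"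
  shows "\<bar>\<integral>x. f x \<partial>M\<bar> \<le> B"
proof -
  have i: "integrable M f" by (rule integrable_bounded[OF assms])
  have "\<bar>\<integral>x. f x \<partial>M\<bar> \<le> (\<integral>x. \<bar>f x\<bar> \<partial>M)"
    using integral_norm_bound[of M f] by simp
  also have "\<dots> \<le> (\<integral>x. B \<partial>M)"
    using i assms by (intro integral_mono) auto
  finally show ?thesis by (simp add: prob_space)
qed

lemma weak_conv_onD:
  assumes "weak_conv_on X mu nu" "continuous_on X g" "\<And>x. x \<in> X \<Longrightarrow> \<bar>g x :: real\<bar> \<le> B"
  shows "(\<lambda>n. \<integral>x. g x \<partial>mu n) \<longlonglongrightarrow> (\<integral>x. g x \<partial>nu)"
proof -
  have "bounded (g ` X)" using assms(3) by (auto simp: bounded_iff)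
  with assms(1,2) show ?thesis unfolding weak_conv_on_def by blast
qed

text \<open>With continuous weights subordinate to a countable cover by balls on which all of
  \<open>F\<close> varies little, each \<open>g\<close> is close to
  \<open>\<Sum>i<k. g (p i) * w k i\<close>. Only the coefficients depend on \<open>g\<close>, and
  they are bounded by \<open>M\<close>, so convergence of finitely many integrals of weights serves
  all of \<open>F\<close> at once.\<close>

lemma weak_conv_on_uniform:
  fixes X :: "'a::euclidean_space set"
  assumes F: "equicont_on X F" and M: "\<And>g x. g \<in> F \<Longrightarrow> x \<in> X \<Longrightarrow> \<bar>g x\<bar> \<le> M"
    and mu: "\<And>n. mu n \<in> space (prob_algebra (borel_on X))"
    and nu: "nu \<in> space (prob_algebra (borel_on X))"
    and conv: "weak_conv_on X mu nu" and e: "0 < e"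
  shows "\<forall>\<^sub>F n in sequentially. \<forall>g\<in>F. \<bar>(\<integral>x. g x \<partial>mu n) - (\<integral>x. g x \<partial>nu)\<bar> \<le> e"
proof (cases "F = {}")
  case False
  note mu' = prob_algebra_borel_onD[OF mu] and nu' = prob_algebra_borel_onD[OF nu]
  interpret nu: prob_space nu by (rule nu')
  have "X \<noteq> {}" using nu.not_empty nu' by simp
  then have M0: "0 \<le> M" using M False by (meson abs_ge_zero all_not_in_conv order_trans)
  \<comment> \<open>The approximations under \<open>mu n\<close> and \<open>nu\<close> will cost
    \<open>M * e' + e'\<close> each and the weights \<open>M * e'\<close>, in total
    \<open>(2 + 3 * M) * e'\<close>, which is at most \<open>e\<close>.\<close>
  define e' where "e' = e / (4 + 3 * M)"
  have e': "e' > 0" using e M0 by (simp add: e'_def)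
  have "\<forall>x\<in>X. \<exists>d>0. \<forall>g\<in>F. \<forall>x'\<in>X. dist x' x < d \<longrightarrow> \<bar>g x' - g x\<bar> \<le> e'"
    using F e' unfolding equicont_on_def by blast
  from bchoice[OF this] obtain r where r: "\<And>x. x \<in> X \<Longrightarrow> r x > 0"
    and osc: "\<And>x x' g. x \<in> X \<Longrightarrow> x' \<in> X \<Longrightarrow> g \<in> F \<Longrightarrow> dist x' x < r x \<Longrightarrow> \<bar>g x' - g x\<bar> \<le> e'"
    by blast
  \<comment> \<open>A countable subcover takes the place of compactness: finitely many of its balls
    carry almost all the mass of \<open>nu\<close>.\<close>
  obtain B where B: "B \<subseteq> (\<lambda>x. ball x (r x)) ` X" "countable B" "\<Union>B = \<Union>((\<lambda>x. ball x (r x)) ` X)"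
    by (rule Lindelof[of "(\<lambda>x. ball x (r x)) ` X"]) auto
  have XB: "X \<subseteq> \<Union>B" unfolding B(3) using r by auto
  then have "B \<noteq> {}" using \<open>X \<noteq> {}\<close> by auto
  then have "range (from_nat_into B) = B" using B(2) by (rule range_from_nat_into)
  with B(1) have "\<forall>i. \<exists>x\<in>X. from_nat_into B i = ball x (r x)"
    by (metis (no_types, lifting) image_iff rangeI subsetD)
  then obtain p where pX: "\<And>i. p i \<in> X" and p: "\<And>i. from_nat_into B i = ball (p i) (r (p i))"
    by metis
  have cover: "\<exists>i. dist x (p i) < r (p i)" if "x \<in> X" for x
    using that XB \<open>range (from_nat_into B) = B\<close> p by (metis UN_E dist_commute mem_ball subsetD)
  \<comment> \<open>The bumps \<open>\<phi> i\<close> are supported on the balls of the cover. Dividing by \<open>max (S k) (1 / (k + 1))\<close>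
    instead of \<open>S k\<close> keeps the weights \<open>w k i\<close> continuous; their sum \<open>h k\<close> then only tends to 1.\<close>
  define \<phi> where "\<phi> i x = max 0 (r (p i) - dist x (p i))" for i x
  define S where "S k x = (\<Sum>i<k. \<phi> i x)" for k x
  define h where "h k x = S k x / max (S k x) (1 / real (Suc k))" for k x
  define w where "w k i x = \<phi> i x / max (S k x) (1 / real (Suc k))" for k i x
  have \<phi>0: "\<phi> i x \<ge> 0" for i x by (simp add: \<phi>_def)
  have S0: "S k x \<ge> 0" for k x unfolding S_def by (intro sum_nonneg \<phi>0)
  have den: "max (S k x) (1 / real (Suc k)) > 0" for k x by (simp add: less_max_iff_disj)
  have w0: "w k i x \<ge> 0" for k i x
    unfolding w_def by (intro divide_nonneg_nonneg \<phi>0 less_imp_le[OF den])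
  have h_sum: "h k x = (\<Sum>i<k. w k i x)" for k x by (simp add: h_def w_def S_def sum_divide_distrib)
  have h0: "0 \<le> h k x" for k x unfolding h_sum by (intro sum_nonneg w0)
  have h1: "h k x \<le> 1" for k x unfolding h_def using den[of k x] by simp
  have w1: "w k i x \<le> 1" if "i < k" for k i x
    using h1[of k x] member_le_sum[of i "{..<k}" "\<lambda>i. w k i x"] w0 that unfolding h_sum by auto
  have cS: "continuous_on X (S k)" for k
    unfolding S_def \<phi>_def by (intro continuous_intros)
  have cw: "continuous_on X (w k i)" for k i
    unfolding w_def \<phi>_def
    by (intro continuous_intros cS) (use den in \<open>force simp: less_le\<close>)
  \<comment> \<open>The weights sum to exactly 1 at \<open>x\<close> as soon as a bump with index
    below \<open>k\<close> exceeds \<open>1 / (k + 1)\<close> there.\<close>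
  have hlim: "(\<lambda>k. h k x) \<longlonglongrightarrow> 1" if x: "x \<in> X" for x
  proof (rule tendsto_eventually)
    obtain i where i: "dist x (p i) < r (p i)" using cover[OF x] by blast
    then have pos: "\<phi> i x > 0" by (simp add: \<phi>_def)
    obtain m where m: "1 / real (Suc m) < \<phi> i x" using pos nat_approx_posE by blast
    have "h k x = 1" if k: "k \<ge> max (Suc i) m" for k
    proof -
      have "1 / real (Suc k) \<le> 1 / real (Suc m)" using k by (simp add: frac_le)
      also have "\<dots> < \<phi> i x" by (rule m)
      also have "\<phi> i x \<le> S k x"
        unfolding S_def using k \<phi>0 by (intro member_le_sum) auto
      finally show ?thesis using pos \<open>\<phi> i x \<le> S k x\<close> by (simp add: h_def max_def)
    qed
    then show "\<forall>\<^sub>F k in sequentially. h k x = 1" unfolding eventually_sequentially by blast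
  qed
  have ch: "continuous_on X (h k)" for k
    unfolding h_sum by (intro continuous_intros cw)
  have meas: "f \<in> borel_measurable \<mu>" if "continuous_on X f" "sets \<mu> = sets (borel_on X)"
    for f :: "'a \<Rightarrow> real" and \<mu>
    using borel_measurable_continuous_on_restrict[OF that(1)] measurable_cong_sets[OF that(2) refl] by blast
  \<comment> \<open>The index \<open>k\<close> is fixed by \<open>nu\<close> alone. As
    \<open>h k\<close> is continuous, weak convergence later passes the bound on to
    \<open>mu n\<close> for large \<open>n\<close>.\<close>
  have "(\<lambda>k. \<integral>x. h k x \<partial>nu) \<longlonglongrightarrow> (\<integral>x. 1 \<partial>nu)"
    using h0 h1 meas[OF ch nu'(2)] hlim nu'(3)
    by (intro integral_dominated_convergence[where w="\<lambda>_. 1"]) (auto intro!: AE_I2)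
  then have "\<forall>\<^sub>F k in sequentially. 1 - e' < (\<integral>x. h k x \<partial>nu)"
    using e' by (intro order_tendstoD) (auto simp: nu.prob_space)
  then obtain k where k: "1 - e' < (\<integral>x. h k x \<partial>nu)"
    by (auto dest: eventually_happens)
  have approx: "\<bar>(\<integral>x. g x \<partial>\<mu>) - (\<Sum>i<k. g (p i) * (\<integral>x. w k i x \<partial>\<mu>))\<bar> \<le> M * (1 - (\<integral>x. h k x \<partial>\<mu>)) + e'"
    if g: "g \<in> F" and \<mu>: "\<mu> \<in> space (prob_algebra (borel_on X))" for g \<mu>
  proof -
    note \<mu>' = prob_algebra_borel_onD[OF \<mu>]
    interpret \<mu>: prob_space \<mu> by (rule \<mu>')
    have ig: "integrable \<mu> g"
      using M g \<mu>' by (intro \<mu>.integrable_bounded[of _ M] meas equicont_on_imp_continuous_on[OF F]) auto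
    have iw: "integrable \<mu> (w k i)" if "i < k" for i
      using w0 w1[OF that] \<mu>' by (intro \<mu>.integrable_bounded[of _ 1] meas cw) auto
    have ih: "integrable \<mu> (h k)"
      using h0 h1 \<mu>' by (intro \<mu>.integrable_bounded[of _ 1] meas ch) auto
    have "(\<integral>x. g x \<partial>\<mu>) - (\<Sum>i<k. g (p i) * (\<integral>x. w k i x \<partial>\<mu>)) =
      (\<integral>x. g x - (\<Sum>i<k. g (p i) * w k i x) \<partial>\<mu>)"
      using ig iw by (subst Bochner_Integration.integral_diff) (auto intro!: Bochner_Integration.integrable_sum
          simp: Bochner_Integration.integral_sum)
    also have "\<bar>\<dots>\<bar> \<le> (\<integral>x. \<bar>g x - (\<Sum>i<k. g (p i) * w k i x)\<bar> \<partial>\<mu>)"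
      using integral_norm_bound[of \<mu> "\<lambda>x. g x - (\<Sum>i<k. g (p i) * w k i x)"] by simp
    also have "\<dots> \<le> (\<integral>x. M * (1 - h k x) + e' \<partial>\<mu>)"
    proof (intro integral_mono)
      show "integrable \<mu> (\<lambda>x. \<bar>g x - (\<Sum>i<k. g (p i) * w k i x)\<bar>)"
        using ig iw by (intro integrable_abs Bochner_Integration.integrable_diff
            Bochner_Integration.integrable_sum integrable_mult_right) auto
      show "integrable \<mu> (\<lambda>x. M * (1 - h k x) + e')" using ih by simp
      fix x assume "x \<in> space \<mu>"
      then have x: "x \<in> X" using \<mu>' by simp
      \<comment> \<open>The first term is due to the missing weight, the second to the oscillation
        of \<open>g\<close>: its summands vanish unless \<open>x\<close> lies in the ball around
        \<open>p i\<close>, where \<open>osc\<close> applies.\<close>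
      have "g x - (\<Sum>i<k. g (p i) * w k i x) = g x * (1 - h k x) + (\<Sum>i<k. (g x - g (p i)) * w k i x)"
        by (simp add: h_sum algebra_simps sum_subtractf sum_distrib_left)
      moreover have "\<bar>g x * (1 - h k x)\<bar> \<le> M * (1 - h k x)"
        using M[OF g x] h1[of k x] by (simp add: abs_mult mult_right_mono)
      moreover have "\<bar>\<Sum>i<k. (g x - g (p i)) * w k i x\<bar> \<le> (\<Sum>i<k. e' * w k i x)"
      proof (rule order_trans[OF sum_abs], rule sum_mono)
        fix i
        show "\<bar>(g x - g (p i)) * w k i x\<bar> \<le> e' * w k i x"
        proof (cases "dist x (p i) < r (p i)")
          case True
          from osc[OF pX x g this] show ?thesis
            using w0[of k i x] by (simp add: abs_mult mult_right_mono)
        next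
          case False
          then show ?thesis by (simp add: w_def \<phi>_def)
        qed
      qed
      moreover have "(\<Sum>i<k. e' * w k i x) \<le> e'"
        using h1[of k x] e' by (simp add: h_sum flip: sum_distrib_left)
      ultimately show "\<bar>g x - (\<Sum>i<k. g (p i) * w k i x)\<bar> \<le> M * (1 - h k x) + e'"
        by linarith
    qed
    also have "\<dots> = M * (1 - (\<integral>x. h k x \<partial>\<mu>)) + e'"
      using ih by (simp add: \<mu>.prob_space)
    finally show ?thesis .
  qed
  have wlim: "(\<lambda>n. \<integral>x. w k i x \<partial>mu n) \<longlonglongrightarrow> (\<integral>x. w k i x \<partial>nu)" if "i < k" for i
    by (rule weak_conv_onD[OF conv cw, of _ _ 1]) (use w0 w1[OF that] in auto)
  have "(\<lambda>n. \<integral>x. h k x \<partial>mu n) \<longlonglongrightarrow> (\<integral>x. h k x \<partial>nu)"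
    by (rule weak_conv_onD[OF conv ch, of _ 1]) (use h0 h1 in auto)
  then have ev1: "\<forall>\<^sub>F n in sequentially. 1 - e' < (\<integral>x. h k x \<partial>mu n)"
    using k by (rule order_tendstoD)
  have "(\<lambda>n. \<Sum>i<k. \<bar>(\<integral>x. w k i x \<partial>mu n) - (\<integral>x. w k i x \<partial>nu)\<bar>) \<longlonglongrightarrow> (\<Sum>i<k. \<bar>(\<integral>x. w k i x \<partial>nu) - (\<integral>x. w k i x \<partial>nu)\<bar>)"
    by (intro tendsto_intros wlim) auto
  then have ev2: "\<forall>\<^sub>F n in sequentially. (\<Sum>i<k. \<bar>(\<integral>x. w k i x \<partial>mu n) - (\<integral>x. w k i x \<partial>nu)\<bar>) < e'"
    using e' by (intro order_tendstoD) auto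
  from ev1 ev2 show ?thesis
  proof eventually_elim
    case (elim n)
    show ?case
    proof
      fix g assume g: "g \<in> F"
      have "\<bar>(\<Sum>i<k. g (p i) * (\<integral>x. w k i x \<partial>mu n)) - (\<Sum>i<k. g (p i) * (\<integral>x. w k i x \<partial>nu))\<bar>
          \<le> (\<Sum>i<k. M * \<bar>(\<integral>x. w k i x \<partial>mu n) - (\<integral>x. w k i x \<partial>nu)\<bar>)"
        unfolding sum_subtractf[symmetric] right_diff_distrib[symmetric]
        by (rule order_trans[OF sum_abs], rule sum_mono) (simp add: abs_mult mult_right_mono M g pX)
      also have "\<dots> \<le> M * e'"
        using elim(2) M0 by (simp flip: sum_distrib_left add: mult_left_mono)
      finally have 1: "\<bar>(\<Sum>i<k. g (p i) * (\<integral>x. w k i x \<partial>mu n)) - (\<Sum>i<k. g (p i) * (\<integral>x. w k i x \<partial>nu))\<bar> \<le> M * e'" .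
      have "M * (1 - (\<integral>x. h k x \<partial>mu n)) \<le> M * e'" "M * (1 - (\<integral>x. h k x \<partial>nu)) \<le> M * e'"
        using elim(1) k M0 by (auto intro!: mult_left_mono)
      then have "\<bar>(\<integral>x. g x \<partial>mu n) - (\<integral>x. g x \<partial>nu)\<bar> \<le> 3 * (M * e') + 2 * e'"
        using 1 approx[OF g mu[of n]] approx[OF g nu] by linarith
      also have "\<dots> \<le> (4 + 3 * M) * e'" using e' by (simp add: algebra_simps)
      also have "\<dots> = e" using M0 by (simp add: e'_def)
      finally show "\<bar>(\<integral>x. g x \<partial>mu n) - (\<integral>x. g x \<partial>nu)\<bar> \<le> e" .
    qed
  qed
qed simp

subsection \<open>Total variation, kernels and the Ionescu-Tulcea measure\<close>

text \<open>Rescaling \<open>f\<close> to \<open>g\<close> with values in \<open>[0, 1]\<close>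
  costs \<open>2 * B\<close>, whose 2 is the factor in \<open>tv_dist\<close>. The average of the
  indicators of \<open>N\<close> superlevel sets is within \<open>1 / N\<close> of \<open>g\<close>,
  and on each of these sets the measures differ by at most the supremum \<open>D\<close>.\<close>

lemma integral_diff_le_tv_dist:
  fixes f :: "'a \<Rightarrow> real"
  assumes mu: "prob_space mu" and nu: "prob_space nu" and s: "sets mu = sets nu"
    and f: "f \<in> borel_measurable mu" and B: "\<And>x. x \<in> space mu \<Longrightarrow> \<bar>f x\<bar> \<le> B" "0 < B"
  shows "\<bar>(\<integral>x. f x \<partial>mu) - (\<integral>x. f x \<partial>nu)\<bar> \<le> B * tv_dist mu nu"
proof -
  interpret mu: prob_space mu by fact
  interpret nu: prob_space nu by fact
  have sp: "space nu = space mu" using sets_eq_imp_space_eq[OF s] by simp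
  define D where "D = (SUP A\<in>sets mu. \<bar>measure mu A - measure nu A\<bar>)"
  \<comment> \<open>A supremum of reals is an upper bound only when the set is bounded
    above.\<close>
  have "bdd_above ((\<lambda>A. \<bar>measure mu A - measure nu A\<bar>) ` sets mu)"
  proof (rule bdd_aboveI2)
    show "\<bar>measure mu A - measure nu A\<bar> \<le> 2" for A
      using mu.prob_le_1[of A] nu.prob_le_1[of A] measure_nonneg[of mu A] measure_nonneg[of nu A] by linarith
  qed
  then have D: "\<bar>measure mu A - measure nu A\<bar> \<le> D" if "A \<in> sets mu" for A
    unfolding D_def using that by (rule cSUP_upper2[OF _ _ order_refl])
  define g where "g x = (f x + B) / (2 * B)" for x
  have g: "g \<in> borel_measurable mu" unfolding g_def using f by simp
  have g': "g \<in> borel_measurable nu" using g measurable_cong_sets[OF s refl] by blast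
  have g01: "0 \<le> g x" "g x \<le> 1" if "x \<in> space mu" for x
    using B(1)[OF that] B(2) by (auto simp: g_def divide_simps)
  have key: "\<bar>(\<integral>x. g x \<partial>mu) - (\<integral>x. g x \<partial>nu)\<bar> \<le> D + 2 / real (Suc n)" for n
  proof -
    define N where "N = Suc n"
    define A where "A k = {x \<in> space mu. real k \<le> N * g x}" for k
    have A: "A k \<in> sets mu" for k unfolding A_def using g by measurable
    have A': "A k \<in> sets nu" for k using A s by simp
    \<comment> \<open>\<open>s = \<lfloor>N * g\<rfloor> / N\<close>\<close>
    define s where "s x = (\<Sum>k=1..N. indicator (A k) x) / real N" for x
    have sg: "s x \<le> g x \<and> g x \<le> s x + 1 / real N" if x: "x \<in> space mu" for x
    proof -
      have ng: "0 \<le> N * g x" "N * g x \<le> real N" using g01[OF x] mult_left_le[of "g x" N] by auto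
      have "(\<Sum>k=1..N. indicator (A k) x :: real) = (\<Sum>k\<in>{1..N}. if k \<le> nat \<lfloor>N * g x\<rfloor> then 1 else 0)"
      proof (rule sum.cong[OF refl])
        fix k
        have "k \<le> nat \<lfloor>N * g x\<rfloor> \<longleftrightarrow> real k \<le> N * g x"
          using ng by (simp add: le_nat_iff le_floor_iff)
        then show "indicator (A k) x = (if k \<le> nat \<lfloor>N * g x\<rfloor> then 1 else (0::real))"
          using x by (simp add: A_def indicator_def)
      qed
      also have "\<dots> = real (card {k\<in>{1..N}. k \<le> nat \<lfloor>N * g x\<rfloor>})"
        by (simp add: sum.inter_filter[symmetric])
      also have "{k\<in>{1..N}. k \<le> nat \<lfloor>N * g x\<rfloor>} = {1..nat \<lfloor>N * g x\<rfloor>}"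
        using ng(2) by (auto simp: le_nat_iff) (metis floor_mono floor_of_nat nat_int nat_mono order_trans)
      finally have "s x = real (nat \<lfloor>N * g x\<rfloor>) / N" by (simp add: s_def)
      then have "N * s x = real (nat \<lfloor>N * g x\<rfloor>)" by (simp add: N_def)
      moreover have "real (nat \<lfloor>N * g x\<rfloor>) \<le> N * g x" "N * g x \<le> real (nat \<lfloor>N * g x\<rfloor>) + 1"
        using ng(1) by linarith+
      moreover have "N > 0" by (simp add: N_def)
      ultimately have "N * s x \<le> N * g x" "N * g x \<le> N * s x + 1" by linarith+
      with \<open>N > 0\<close> show ?thesis by (simp add: field_simps)
    qed
    have one: "(\<integral>x. g x \<partial>\<mu>) \<in> {(\<Sum>k=1..N. measure \<mu> (A k)) / N .. (\<Sum>k=1..N. measure \<mu> (A k)) / N + 1 / N}"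
      if p: "prob_space \<mu>" and gm: "g \<in> borel_measurable \<mu>" and A: "\<And>k. A k \<in> sets \<mu>" and sp: "space \<mu> = space mu" for \<mu>
    proof -
      interpret prob_space \<mu> by fact
      have ig: "integrable \<mu> g" using g01 sp by (intro integrable_bounded[OF gm, of 1]) auto
      have ii: "integrable \<mu> (indicator (A k) :: _ \<Rightarrow> real)" for k
        using A by (intro integrable_real_indicator) (auto simp: emeasure_eq_measure)
      have int_s: "integrable \<mu> s" unfolding s_def using ii by auto
      have si: "(\<integral>x. s x \<partial>\<mu>) = (\<Sum>k=1..N. measure \<mu> (A k)) / N"
        unfolding s_def using A ii by simp
      have "(\<integral>x. s x \<partial>\<mu>) \<le> (\<integral>x. g x \<partial>\<mu>)" using sg sp by (intro integral_mono int_s ig) auto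
      moreover have "(\<integral>x. g x \<partial>\<mu>) \<le> (\<integral>x. s x + 1 / N \<partial>\<mu>)" using sg sp int_s by (intro integral_mono ig) auto
      ultimately show ?thesis using int_s by (simp add: si prob_space)
    qed
    \<comment> \<open>The \<open>N\<close> differences add up to at most \<open>N * D\<close>; the
      division by \<open>N\<close> in the staircase removes the factor.\<close>
    have "\<bar>(\<Sum>k=1..N. measure mu (A k)) - (\<Sum>k=1..N. measure nu (A k))\<bar> \<le> (\<Sum>k=1..N. D)"
      unfolding sum_subtractf[symmetric]
      by (rule order_trans[OF sum_abs], rule sum_mono) (rule D[OF A])
    then have "\<bar>(\<Sum>k=1..N. measure mu (A k)) / N - (\<Sum>k=1..N. measure nu (A k)) / N\<bar> \<le> D"
      by (simp add: diff_divide_distrib[symmetric] N_def field_simps)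
    moreover have "2 / real N = 1 / real N + 1 / real N" by simp
    ultimately show ?thesis
      using one[OF mu g A refl] one[OF nu g' A' sp] unfolding N_def[symmetric] atLeastAtMost_iff
      by linarith
  qed
  have "(\<lambda>n. D + 2 * inverse (real (Suc n))) \<longlonglongrightarrow> D + 2 * 0"
    by (intro tendsto_intros LIMSEQ_inverse_real_of_nat)
  from LIMSEQ_le_const[OF this] have gD: "\<bar>(\<integral>x. g x \<partial>mu) - (\<integral>x. g x \<partial>nu)\<bar> \<le> D"
    using key by (auto simp: divide_inverse)
  have fg: "f x = 2 * B * g x - B" for x using B(2) by (simp add: g_def field_simps)
  have "integrable mu g" using g01 by (intro mu.integrable_bounded[OF g, of 1]) auto
  moreover have "integrable nu g" using g01 sp by (intro nu.integrable_bounded[OF g', of 1]) auto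
  ultimately have "(\<integral>x. f x \<partial>mu) - (\<integral>x. f x \<partial>nu) = 2 * B * ((\<integral>x. g x \<partial>mu) - (\<integral>x. g x \<partial>nu))"
    unfolding fg by (simp add: mu.prob_space nu.prob_space algebra_simps)
  then have "\<bar>(\<integral>x. f x \<partial>mu) - (\<integral>x. f x \<partial>nu)\<bar> = 2 * B * \<bar>(\<integral>x. g x \<partial>mu) - (\<integral>x. g x \<partial>nu)\<bar>"
    using B(2) by (simp add: abs_mult)
  also have "\<dots> \<le> 2 * B * D" using gD B(2) by (intro mult_left_mono) auto
  finally show ?thesis by (simp add: tv_dist_def D_def)
qed

section \<open>Integration against stochastic kernels\<close>

lemma measurable_integral_kernel:
  fixes f :: "'a \<Rightarrow> 'b \<Rightarrow> real"
  assumes f: "case_prod f \<in> borel_measurable (M \<Otimes>\<^sub>M N)" and L: "L \<in> M \<rightarrow>\<^sub>M prob_algebra N"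
  shows "(\<lambda>x. \<integral>y. f x y \<partial>L x) \<in> borel_measurable M"
proof -
  \<comment> \<open>Pushing \<open>L x\<close> forward along \<open>Pair x\<close> moves the
    parameter from the integrand into the measure, leaving the fixed integrand
    \<open>case_prod f\<close>.\<close>
  have "(\<lambda>x. distr (L x) (M \<Otimes>\<^sub>M N) (Pair x)) \<in> M \<rightarrow>\<^sub>M prob_algebra (M \<Otimes>\<^sub>M N)"
    by (intro measurable_distr_prob_space2[OF L]) (simp add: split_beta')
  from measurable_compose[OF measurable_prob_algebraD[OF this] integral_measurable_subprob_algebra[OF f]]
  have "(\<lambda>x. integral\<^sup>L (distr (L x) (M \<Otimes>\<^sub>M N) (Pair x)) (case_prod f)) \<in> borel_measurable M" .
  also have "?this \<longleftrightarrow> ?thesis"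
  proof (rule measurable_cong)
    fix x assume x: "x \<in> space M"
    then have "sets (L x) = sets N"
      using measurable_space[OF L x] by (simp add: space_prob_algebra)
    then have "Pair x \<in> L x \<rightarrow>\<^sub>M M \<Otimes>\<^sub>M N"
      using measurable_Pair1'[OF x, of N] measurable_cong_sets[of "L x" N] by blast
    from integral_distr[OF this f]
    show "integral\<^sup>L (distr (L x) (M \<Otimes>\<^sub>M N) (Pair x)) (case_prod f) = (\<integral>y. f x y \<partial>L x)" by simp
  qed
  finally show ?thesis .
qed

lemma integral_bind_prob:
  fixes f :: "'b \<Rightarrow> real"
  assumes "f \<in> borel_measurable K" "\<And>x. x \<in> space K \<Longrightarrow> \<bar>f x\<bar> \<le> B"
    and N: "N \<in> M \<rightarrow>\<^sub>M prob_algebra K" and M: "prob_space M"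
  shows "integral\<^sup>L (M \<bind> N) f = (\<integral>x. integral\<^sup>L (N x) f \<partial>M)"
proof (rule integral_bind[OF assms(1,2)])
  interpret prob_space M by fact
  show "N \<in> M \<rightarrow>\<^sub>M subprob_algebra K" by (rule measurable_prob_algebraD[OF N])
  show "finite_measure M" by unfold_locales
  have "emeasure (N x) (space (N x)) \<le> ennreal 1" if "x \<in> space M" for x
    using measurable_space[OF N that] by (simp add: space_prob_algebra prob_space.emeasure_space_1)
  then show "AE x in M. emeasure (N x) (space (N x)) \<le> ennreal 1" by (rule AE_I2)
qed

section \<open>Marginals of the Ionescu-Tulcea measure\<close>

lemma (in Ionescu_Tulcea) distr_lim_C:
  "distr PF.lim (PiM {0..<n} M) (\<lambda>\<omega>. restrict \<omega> {0..<n}) = C 0 n (\<lambda>_. undefined)"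
proof -
  \<comment> \<open>The marginal on an index set \<open>J\<close> is built from the first
    \<open>up_to J\<close> stages; for an initial segment these are exactly \<open>n\<close>
    stages.\<close>
  have "up_to {0..<n} = n"
    using up_to[of "{0..<n}"] by (intro antisym) (auto simp: up_to_iff_Ico simp del: up_to_iff)
  then show ?thesis
    using distr_C[of n n "\<lambda>_. undefined" 0] by (simp add: distr_lim CI_def)
qed

text \<open>The total mass can be read off any marginal, in particular the one on the empty index
  set.\<close>

lemma (in Ionescu_Tulcea) prob_space_lim: "prob_space PF.lim"
proof (rule prob_space_distrD)
  show "(\<lambda>\<omega>. restrict \<omega> {}) \<in> PF.lim \<rightarrow>\<^sub>M PiM {} M"
    using measurable_cong_sets[OF PF.sets_lim refl] by (auto intro!: measurable_restrict_subset)
  show "prob_space (distr PF.lim (PiM {} M) (\<lambda>\<omega>. restrict \<omega> {}))"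
    by (simp add: distr_lim PF.prob_space_P)
qed

text \<open>The tower property for the last coordinate: \<open>C 0 (Suc n)\<close> is
  \<open>C 0 n\<close> followed by \<open>eP n\<close>, and \<open>eP n h\<close> is the image of
  \<open>P n h\<close> under \<open>\<lambda>z. h(n := z)\<close>.\<close>

lemma (in Ionescu_Tulcea) integral_lim_Suc:
  fixes f :: "(nat \<Rightarrow> 'a) \<Rightarrow> real"
  assumes f: "f \<in> borel_measurable (PiM {0..<Suc n} M)"
    and B: "\<And>h. h \<in> space (PiM {0..<Suc n} M) \<Longrightarrow> \<bar>f h\<bar> \<le> B"
  shows "(\<integral>\<omega>. f (restrict \<omega> {0..<Suc n}) \<partial>PF.lim) =
    (\<integral>\<omega>. (\<integral>z. f ((restrict \<omega> {0..<n})(n := z)) \<partial>P n (restrict \<omega> {0..<n})) \<partial>PF.lim)"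
proof -
  have r[measurable]: "(\<lambda>\<omega>. restrict \<omega> {0..<m}) \<in> PF.lim \<rightarrow>\<^sub>M PiM {0..<m} M" for m
    using measurable_cong_sets[OF PF.sets_lim refl] by (auto intro!: measurable_restrict_subset)
  have lim: "(\<integral>\<omega>. g (restrict \<omega> {0..<m}) \<partial>PF.lim) = (\<integral>h. g h \<partial>C 0 m (\<lambda>_. undefined))"
    if "g \<in> borel_measurable (PiM {0..<m} M)" for g :: "(nat \<Rightarrow> 'a) \<Rightarrow> real" and m
    using integral_distr[OF r that] by (simp add: distr_lim_C)
  have u: "(\<lambda>_. undefined) \<in> space (PiM {0..<0} M)" by (simp add: space_PiM)
  interpret Cn: prob_space "C 0 n (\<lambda>_. undefined)" by (rule prob_space_C[OF u])
  have sC: "sets (C 0 n (\<lambda>_. undefined)) = sets (PiM {0..<n} M)" using sets_C[OF u, of n] by simp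
  have eP: "eP n \<in> C 0 n (\<lambda>_. undefined) \<rightarrow>\<^sub>M prob_algebra (PiM {0..<Suc n} M)"
    using measurable_eP[of n] measurable_cong_sets[OF sC refl, of "subprob_algebra (PiM {0..<Suc n} M)"]
      sets_eq_imp_space_eq[OF sC]
    by (intro measurable_prob_algebraI) (auto intro: prob_space_eP)
  have eq: "(\<integral>h'. f h' \<partial>eP n h) = (\<integral>z. f (h(n := z)) \<partial>P n h)" if h: "h \<in> space (PiM {0..<n} M)" for h
    unfolding eP_def using h by (intro integral_distr f measurable_fun_upd[where J="{0..<n}"]) auto
  have "(\<integral>\<omega>. f (restrict \<omega> {0..<Suc n}) \<partial>PF.lim) = (\<integral>h. f h \<partial>(C 0 n (\<lambda>_. undefined) \<bind> eP n))"
    using lim[OF f] by simp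
  also have "\<dots> = (\<integral>h. (\<integral>h'. f h' \<partial>eP n h) \<partial>C 0 n (\<lambda>_. undefined))"
    by (rule integral_bind_prob[OF f B eP Cn.prob_space_axioms])
  also have "\<dots> = (\<integral>\<omega>. (\<integral>h'. f h' \<partial>eP n (restrict \<omega> {0..<n})) \<partial>PF.lim)"
    by (rule lim[symmetric]) (use f in measurable)
  also have "\<dots> = (\<integral>\<omega>. (\<integral>z. f ((restrict \<omega> {0..<n})(n := z)) \<partial>P n (restrict \<omega> {0..<n})) \<partial>PF.lim)"
    using measurable_space[OF r] by (intro Bochner_Integration.integral_cong refl eq) auto
  finally show ?thesis .
qed

subsection \<open>The cost-to-go\<close>

text \<open>\<open>M\<close> is a strictly positive bound of the cost, so that
  \<open>M / (1 - \<beta>)\<close> is positive, as the total variation estimate demands.\<close>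

locale pomdp =
  fixes X :: "'x::euclidean_space set" and Y :: "'y::euclidean_space set"
    and U :: "'u::euclidean_space set"
    and Q :: "'x \<Rightarrow> 'y measure" and T :: "'x \<times> 'u \<Rightarrow> 'x measure"
    and c :: "'x \<times> 'u \<Rightarrow> real" and \<beta> M :: real
  assumes Q[measurable]: "Q \<in> borel_on X \<rightarrow>\<^sub>M prob_algebra (borel_on Y)"
    and T[measurable]: "T \<in> borel_on X \<Otimes>\<^sub>M borel_on U \<rightarrow>\<^sub>M prob_algebra (borel_on X)"
    and \<beta>: "0 < \<beta>" "\<beta> < 1"
    and c_cont: "continuous_on (X \<times> U) c"
    and c_nonneg: "\<And>z. z \<in> X \<times> U \<Longrightarrow> 0 \<le> c z"
    and c_le: "\<And>z. z \<in> X \<times> U \<Longrightarrow> c z \<le> M"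
    and M: "0 < M"
begin

text \<open>Continuity gives measurability on the subspace \<open>X \<times> U\<close>; the identity
  map carries it to the product of the two restricted spaces, by \<open>borel_prod\<close>.\<close>

lemma measurable_c[measurable]: "c \<in> borel_measurable (borel_on X \<Otimes>\<^sub>M borel_on U)"
proof -
  have "(\<lambda>z. (fst z, snd z)) \<in> borel_on X \<Otimes>\<^sub>M borel_on U \<rightarrow>\<^sub>M borel \<Otimes>\<^sub>M borel"
    by (intro measurable_Pair measurable_compose[OF measurable_fst] measurable_compose[OF measurable_snd]
        measurable_restrict_space1 measurable_ident_sets refl)
  then have "(\<lambda>z. z) \<in> borel_on X \<Otimes>\<^sub>M borel_on U \<rightarrow>\<^sub>M borel"
    by (simp add: borel_prod)
  then have "(\<lambda>z. z) \<in> borel_on X \<Otimes>\<^sub>M borel_on U \<rightarrow>\<^sub>M borel_on (X \<times> U)"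
    by (intro measurable_restrict_space2) (auto simp: space_pair_measure space_restrict_space)
  from measurable_compose[OF this borel_measurable_continuous_on_restrict[OF c_cont]]
  show ?thesis by simp
qed

abbreviation bound :: real where "bound \<equiv> M / (1 - \<beta>)"

lemma bound_pos: "0 < bound"
  using M \<beta> by simp

text \<open>\<open>bound\<close> reproduces itself when a stage is prepended, so one bound serves
  all horizons.\<close>

lemma bound_fixpoint: "M + \<beta> * bound = bound"
  using \<beta> by (simp add: field_simps)

lemma Q_space: "x \<in> X \<Longrightarrow> Q x \<in> space (prob_algebra (borel_on Y))"
  using measurable_space[OF Q] by (simp add: space_restrict_space)

lemma T_space: "x \<in> X \<Longrightarrow> u \<in> U \<Longrightarrow> T (x, u) \<in> space (prob_algebra (borel_on X))"
  using measurable_space[OF T] by (simp add: space_restrict_space space_pair_measure)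

text \<open>The one-step Bellman operator for a fixed action. \<open>g\<close> depends on the next
  state alone, because the information handed on is settled by the current observation and
  action.\<close>

definition stage_value :: "('x \<Rightarrow> real) \<Rightarrow> 'x \<Rightarrow> 'u \<Rightarrow> real" where
  "stage_value g x u = c (x, u) + \<beta> * (\<integral>x'. g x' \<partial>T (x, u))"

lemma stage_sum_bound:
  assumes "z \<in> X \<times> U" "\<bar>w\<bar> \<le> bound"
  shows "\<bar>c z + \<beta> * w\<bar> \<le> bound"
proof -
  have "\<bar>c z + \<beta> * w\<bar> \<le> c z + \<beta> * \<bar>w\<bar>"
    using \<beta> c_nonneg[OF assms(1)] by (intro order_trans[OF abs_triangle_ineq]) (simp add: abs_mult)
  also have "\<dots> \<le> M + \<beta> * bound"
    using \<beta> c_le[OF assms(1)] assms(2) by (intro add_mono mult_left_mono) auto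
  finally show ?thesis by (simp only: bound_fixpoint)
qed

lemma stage_value_bound:
  assumes "g \<in> borel_measurable (borel_on X)" "\<And>x. x \<in> X \<Longrightarrow> \<bar>g x\<bar> \<le> bound" "x \<in> X" "u \<in> U"
  shows "\<bar>stage_value g x u\<bar> \<le> bound"
proof -
  note T' = prob_algebra_borel_onD[OF T_space[OF assms(3,4)]]
  have "\<bar>\<integral>x'. g x' \<partial>T (x, u)\<bar> \<le> bound"
    using assms(1,2) T' measurable_cong_sets[OF T'(2) refl] by (intro prob_space.abs_integral_le_bound) auto
  then show ?thesis
    unfolding stage_value_def using assms(3,4) by (intro stage_sum_bound) auto
qed

text \<open>This is the information before the current observation, whereas
  \<open>\<gamma> t\<close> takes observations indexed by \<open>{..t}\<close>. Keeping the new
  observation apart lets it be integrated out against \<open>Q x\<close>.\<close>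

abbreviation info_space :: "nat \<Rightarrow> ((nat \<Rightarrow> 'y) \<times> (nat \<Rightarrow> 'u)) measure" where
  "info_space t \<equiv> PiM {..<t} (\<lambda>_. borel_on Y) \<Otimes>\<^sub>M PiM {..<t} (\<lambda>_. borel_on U)"

definition ctrl :: "('y, 'u) policy \<Rightarrow> nat \<Rightarrow> (nat \<Rightarrow> 'y) \<times> (nat \<Rightarrow> 'u) \<Rightarrow> 'y \<Rightarrow> 'u" where
  "ctrl \<gamma> t i y = \<gamma> t ((fst i)(t := y), snd i)"

definition next_info :: "('y, 'u) policy \<Rightarrow> nat \<Rightarrow> (nat \<Rightarrow> 'y) \<times> (nat \<Rightarrow> 'u) \<Rightarrow> 'y \<Rightarrow> (nat \<Rightarrow> 'y) \<times> (nat \<Rightarrow> 'u)" where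
  "next_info \<gamma> t i y = ((fst i)(t := y), (snd i)(t := ctrl \<gamma> t i y))"

text \<open>\<open>cost_to_go \<gamma> k t i x\<close> is the expected discounted cost of the \<open>k\<close> stages from time \<open>t\<close> on, given
  \<open>X\<^sub>t = x\<close> and the information \<open>i = ((Y\<^sub>0, \<dots>, Y\<^sub>t\<^sub>-\<^sub>1), (U\<^sub>0, \<dots>, U\<^sub>t\<^sub>-\<^sub>1))\<close>, that is, before
  \<open>Y\<^sub>t\<close> is observed.\<close>

primrec cost_to_go :: "('y, 'u) policy \<Rightarrow> nat \<Rightarrow> nat \<Rightarrow> (nat \<Rightarrow> 'y) \<times> (nat \<Rightarrow> 'u) \<Rightarrow> 'x \<Rightarrow> real" where
  "cost_to_go \<gamma> 0 t i x = 0"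
| "cost_to_go \<gamma> (Suc k) t i x =
     (\<integral>y. stage_value (cost_to_go \<gamma> k (Suc t) (next_info \<gamma> t i y)) x (ctrl \<gamma> t i y) \<partial>Q x)"

lemma measurable_ctrl:
  assumes "\<gamma> \<in> admissible Y U"
  shows "(\<lambda>(i, y). ctrl \<gamma> t i y) \<in> info_space t \<Otimes>\<^sub>M borel_on Y \<rightarrow>\<^sub>M borel_on U"
proof -
  have "\<gamma> t \<in> PiM {..t} (\<lambda>_. borel_on Y) \<Otimes>\<^sub>M PiM {..<t} (\<lambda>_. borel_on U) \<rightarrow>\<^sub>M borel_on U"
    using assms by (simp add: admissible_def)
  moreover have "(\<lambda>p. ((fst (fst p))(t := snd p), snd (fst p))) \<in> info_space t \<Otimes>\<^sub>M borel_on Y \<rightarrow>\<^sub>M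
      PiM {..t} (\<lambda>_. borel_on Y) \<Otimes>\<^sub>M PiM {..<t} (\<lambda>_. borel_on U)"
    by (intro measurable_Pair measurable_fun_upd[where J="{..<t}"]) auto
  ultimately show ?thesis
    unfolding ctrl_def split_beta' by (rule measurable_compose[rotated])
qed

lemma measurable_next_info:
  assumes "\<gamma> \<in> admissible Y U"
  shows "(\<lambda>(i, y). next_info \<gamma> t i y) \<in> info_space t \<Otimes>\<^sub>M borel_on Y \<rightarrow>\<^sub>M info_space (Suc t)"
  using measurable_ctrl[OF assms, of t] unfolding next_info_def split_beta'
  by (intro measurable_Pair measurable_fun_upd[where J="{..<t}"]) auto

lemma ctrl_in_U:
  assumes "\<gamma> \<in> admissible Y U" "i \<in> space (info_space t)" "y \<in> Y"
  shows "ctrl \<gamma> t i y \<in> U"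
  using measurable_space[OF measurable_ctrl[OF assms(1)], of "(i, y)"] assms(2,3)
  by (simp add: space_pair_measure space_restrict_space)

lemma next_info_space:
  assumes "\<gamma> \<in> admissible Y U" "i \<in> space (info_space t)" "y \<in> Y"
  shows "next_info \<gamma> t i y \<in> space (info_space (Suc t))"
  using measurable_space[OF measurable_next_info[OF assms(1)], of "(i, y)" t] assms(2,3)
  by (simp add: space_pair_measure space_restrict_space)

text \<open>Measurability is needed jointly in \<open>i\<close>, \<open>x\<close> and
  \<open>y\<close>, because \<open>y\<close> also enters the information passed to \<open>f\<close>
  and the action passed to \<open>T\<close>.\<close>

lemma measurable_stage_value:
  assumes \<gamma>: "\<gamma> \<in> admissible Y U"
    and f: "(\<lambda>(i, x). f i x) \<in> borel_measurable (info_space (Suc t) \<Otimes>\<^sub>M borel_on X)"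
  shows "(\<lambda>((i, x), y). stage_value (f (next_info \<gamma> t i y)) x (ctrl \<gamma> t i y))
    \<in> borel_measurable ((info_space t \<Otimes>\<^sub>M borel_on X) \<Otimes>\<^sub>M borel_on Y)" (is "_ \<in> borel_measurable ?D")
proof -
  have iy: "(\<lambda>p. (fst (fst p), snd p)) \<in> ?D \<rightarrow>\<^sub>M info_space t \<Otimes>\<^sub>M borel_on Y"
    by measurable
  have u: "(\<lambda>p. ctrl \<gamma> t (fst (fst p)) (snd p)) \<in> ?D \<rightarrow>\<^sub>M borel_on U"
    using measurable_compose[OF iy measurable_ctrl[OF \<gamma>]] by simp
  have n: "(\<lambda>p. next_info \<gamma> t (fst (fst p)) (snd p)) \<in> ?D \<rightarrow>\<^sub>M info_space (Suc t)"
    using measurable_compose[OF iy measurable_next_info[OF \<gamma>]] by simp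
  have xu: "(\<lambda>p. (snd (fst p), ctrl \<gamma> t (fst (fst p)) (snd p))) \<in> ?D \<rightarrow>\<^sub>M borel_on X \<Otimes>\<^sub>M borel_on U"
    using u by (intro measurable_Pair) auto
  have "(\<lambda>q. (next_info \<gamma> t (fst (fst (fst q))) (snd (fst q)), snd q)) \<in> ?D \<Otimes>\<^sub>M borel_on X \<rightarrow>\<^sub>M
      info_space (Suc t) \<Otimes>\<^sub>M borel_on X"
    using measurable_compose[OF measurable_fst n] by (intro measurable_Pair) auto
  from measurable_compose[OF this f]
  have "(\<lambda>p. \<integral>x'. f (next_info \<gamma> t (fst (fst p)) (snd p)) x' \<partial>T (snd (fst p), ctrl \<gamma> t (fst (fst p)) (snd p)))
      \<in> borel_measurable ?D"
    by (intro measurable_integral_kernel[OF _ measurable_compose[OF xu T]]) (simp add: split_beta')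
  then show ?thesis
    unfolding stage_value_def split_beta'
    using measurable_compose[OF xu measurable_c] by (intro borel_measurable_add borel_measurable_times) auto
qed

lemma measurable_cost_to_go:
  assumes \<gamma>: "\<gamma> \<in> admissible Y U"
  shows "(\<lambda>(i, x). cost_to_go \<gamma> k t i x) \<in> borel_measurable (info_space t \<Otimes>\<^sub>M borel_on X)"
proof (induction k arbitrary: t)
  case (Suc k)
  have "(\<lambda>p. Q (snd p)) \<in> info_space t \<Otimes>\<^sub>M borel_on X \<rightarrow>\<^sub>M prob_algebra (borel_on Y)"
    by measurable
  from measurable_integral_kernel[OF _ this,
      of "\<lambda>(i, x) y. stage_value (cost_to_go \<gamma> k (Suc t) (next_info \<gamma> t i y)) x (ctrl \<gamma> t i y)"]
  show ?case
    using measurable_stage_value[OF \<gamma> Suc.IH] by (simp add: split_beta')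
qed (simp add: split_beta')

lemma measurable_cost_to_go2:
  assumes "\<gamma> \<in> admissible Y U" "i \<in> space (info_space t)"
  shows "cost_to_go \<gamma> k t i \<in> borel_measurable (borel_on X)"
  using measurable_Pair2[OF measurable_cost_to_go[OF assms(1)] assms(2)] by simp

lemma measurable_stage_value2:
  assumes "\<gamma> \<in> admissible Y U" "i \<in> space (info_space t)" "x \<in> X"
  shows "(\<lambda>y. stage_value (cost_to_go \<gamma> k (Suc t) (next_info \<gamma> t i y)) x (ctrl \<gamma> t i y))
    \<in> borel_measurable (borel_on Y)"
  using measurable_Pair2[OF measurable_stage_value[OF assms(1) measurable_cost_to_go[OF assms(1)]], of "(i, x)"] assms(2,3)
  by (simp add: space_pair_measure space_restrict_space)

lemma cost_to_go_bound:
  assumes \<gamma>: "\<gamma> \<in> admissible Y U"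
  shows "i \<in> space (info_space t) \<Longrightarrow> x \<in> X \<Longrightarrow> \<bar>cost_to_go \<gamma> k t i x\<bar> \<le> bound"
proof (induction k arbitrary: t i x)
  case (Suc k)
  note Q' = prob_algebra_borel_onD[OF Q_space[OF Suc.prems(2)]]
  show ?case
    unfolding cost_to_go.simps
  proof (rule prob_space.abs_integral_le_bound[OF Q'(1)])
    show "(\<lambda>y. stage_value (cost_to_go \<gamma> k (Suc t) (next_info \<gamma> t i y)) x (ctrl \<gamma> t i y)) \<in> borel_measurable (Q x)"
      using measurable_stage_value2[OF \<gamma> Suc.prems] measurable_cong_sets[OF Q'(2) refl] by blast
    fix y assume "y \<in> space (Q x)"
    then have "y \<in> Y" using Q' by simp
    with Suc.prems \<gamma> show "\<bar>stage_value (cost_to_go \<gamma> k (Suc t) (next_info \<gamma> t i y)) x (ctrl \<gamma> t i y)\<bar> \<le> bound"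
      by (intro stage_value_bound measurable_cost_to_go2[OF \<gamma>] Suc.IH next_info_space ctrl_in_U)
  qed
qed (use bound_pos in simp)

subsection \<open>Dynamic programming along the trajectory law\<close>

abbreviation hist_space :: "nat \<Rightarrow> (nat \<Rightarrow> 'x \<times> 'y \<times> 'u) measure" where
  "hist_space t \<equiv> PiM {0..<t} (\<lambda>_. stage_space X Y U)"

definition past_info :: "nat \<Rightarrow> (nat \<Rightarrow> 'x \<times> 'y \<times> 'u) \<Rightarrow> (nat \<Rightarrow> 'y) \<times> (nat \<Rightarrow> 'u)" where
  "past_info t h = ((\<lambda>i\<in>{..<t}. obs (h i)), (\<lambda>i\<in>{..<t}. act (h i)))"

definition next_state_law :: "'x measure \<Rightarrow> nat \<Rightarrow> (nat \<Rightarrow> 'x \<times> 'y \<times> 'u) \<Rightarrow> 'x measure" where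
  "next_state_law P t h = (if t = 0 then P else T (st (h (t - 1)), act (h (t - 1))))"

text \<open>The conditioning is on the whole history including past states, so the current state has
  law \<open>P\<close> or a value of \<open>T\<close>, and no filter is involved.\<close>

definition expected_cost_to_go ::
    "'x measure \<Rightarrow> ('y, 'u) policy \<Rightarrow> nat \<Rightarrow> nat \<Rightarrow> (nat \<Rightarrow> 'x \<times> 'y \<times> 'u) \<Rightarrow> real" where
  "expected_cost_to_go P \<gamma> k t h = (\<integral>x. cost_to_go \<gamma> k t (past_info t h) x \<partial>next_state_law P t h)"

lemma measurable_past_info: "past_info t \<in> hist_space t \<rightarrow>\<^sub>M info_space t"
proof -
  have "(\<lambda>h. h i) \<in> hist_space t \<rightarrow>\<^sub>M stage_space X Y U" if "i \<in> {..<t}" for i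
    using that by (intro measurable_component_singleton) auto
  from measurable_compose[OF this measurable_obs] measurable_compose[OF this measurable_act]
  show ?thesis
    unfolding past_info_def by (intro measurable_Pair measurable_restrict)
qed

lemma measurable_next_state_law:
  assumes "P \<in> space (prob_algebra (borel_on X))"
  shows "next_state_law P t \<in> hist_space t \<rightarrow>\<^sub>M prob_algebra (borel_on X)"
proof (cases "t = 0")
  case False
  then have [measurable]: "(\<lambda>h. h (t - 1)) \<in> hist_space t \<rightarrow>\<^sub>M stage_space X Y U"
    by (intro measurable_component_singleton) auto
  show ?thesis using False unfolding next_state_law_def[abs_def] by simp
qed (use assms in \<open>simp add: next_state_law_def[abs_def]\<close>)

text \<open>Reconciles two encodings of the same information: \<open>information\<close> decides by
  \<open>i < t\<close>, \<open>ctrl\<close> updates at index \<open>t\<close>.\<close>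

lemma ctrl_past_info: "\<gamma> t (information t h y) = ctrl \<gamma> t (past_info t h) y"
proof -
  have "(\<lambda>i\<in>{..t}. if i < t then obs (h i) else y) = (\<lambda>i\<in>{..<t}. obs (h i))(t := y)"
    by (auto simp: fun_eq_iff restrict_def)
  then show ?thesis by (simp add: information_def ctrl_def past_info_def)
qed

lemma past_info_Suc:
  "past_info (Suc t) (h(t := (x, y, ctrl \<gamma> t (past_info t h) y))) = next_info \<gamma> t (past_info t h) y"
  by (auto simp: past_info_def next_info_def fun_eq_iff restrict_def obs_def act_def)

lemma measurable_expected_cost_to_go:
  assumes "P \<in> space (prob_algebra (borel_on X))" "\<gamma> \<in> admissible Y U"
  shows "expected_cost_to_go P \<gamma> k t \<in> borel_measurable (hist_space t)"
  unfolding expected_cost_to_go_def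
proof (rule measurable_integral_kernel[OF _ measurable_next_state_law[OF assms(1)]])
  have "(\<lambda>p. (past_info t (fst p), snd p)) \<in> hist_space t \<Otimes>\<^sub>M borel_on X \<rightarrow>\<^sub>M info_space t \<Otimes>\<^sub>M borel_on X"
    by (intro measurable_Pair measurable_compose[OF measurable_fst measurable_past_info]) auto
  from measurable_compose[OF this measurable_cost_to_go[OF assms(2)]]
  show "(\<lambda>(h, x). cost_to_go \<gamma> k t (past_info t h) x) \<in> borel_measurable (hist_space t \<Otimes>\<^sub>M borel_on X)"
    by (simp add: split_beta')
qed

lemma expected_cost_to_go_bound:
  assumes P: "P \<in> space (prob_algebra (borel_on X))" and \<gamma>: "\<gamma> \<in> admissible Y U"
    and h: "h \<in> space (hist_space t)"
  shows "\<bar>expected_cost_to_go P \<gamma> k t h\<bar> \<le> bound"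
proof -
  note L = prob_algebra_borel_onD[OF measurable_space[OF measurable_next_state_law[OF P] h]]
  note i = measurable_space[OF measurable_past_info h]
  show ?thesis
    unfolding expected_cost_to_go_def
    using cost_to_go_bound[OF \<gamma> i] measurable_cost_to_go2[OF \<gamma> i] L measurable_cong_sets[OF L(2) refl]
    by (intro prob_space.abs_integral_le_bound) auto
qed

text \<open>The nested binds become iterated integrals because \<open>f\<close> is bounded, and
  \<open>return\<close> evaluates \<open>f\<close> at the triple.\<close>

lemma integral_stage_kernel:
  fixes f :: "'x \<times> 'y \<times> 'u \<Rightarrow> real"
  assumes P: "P \<in> space (prob_algebra (borel_on X))" and \<gamma>: "\<gamma> \<in> admissible Y U"
    and h: "h \<in> space (hist_space t)"
    and f: "f \<in> borel_measurable (stage_space X Y U)"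
    and B: "\<And>z. z \<in> space (stage_space X Y U) \<Longrightarrow> \<bar>f z\<bar> \<le> B"
  shows "(\<integral>z. f z \<partial>stage_kernel X Y U Q P T \<gamma> t h) =
    (\<integral>x. (\<integral>y. f (x, y, ctrl \<gamma> t (past_info t h) y) \<partial>Q x) \<partial>next_state_law P t h)"
proof -
  let ?S = "stage_space X Y U" and ?u = "ctrl \<gamma> t (past_info t h)"
  note L = prob_algebra_borel_onD[OF measurable_space[OF measurable_next_state_law[OF P] h]]
  note i = measurable_space[OF measurable_past_info h]
  have u[measurable]: "?u \<in> borel_on Y \<rightarrow>\<^sub>M borel_on U"
    using measurable_Pair2[OF measurable_ctrl[OF \<gamma>] i] by simp
  have "(\<lambda>p. return ?S (fst p, snd p, ?u (snd p))) \<in> borel_on X \<Otimes>\<^sub>M borel_on Y \<rightarrow>\<^sub>M prob_algebra ?S"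
    by measurable
  then have K: "(\<lambda>x. Q x \<bind> (\<lambda>y. return ?S (x, y, ?u y))) \<in> borel_on X \<rightarrow>\<^sub>M prob_algebra ?S"
    by (intro measurable_bind_prob_space2[OF Q]) (simp add: split_beta')
  have inner: "(\<integral>z. f z \<partial>(Q x \<bind> (\<lambda>y. return ?S (x, y, ?u y)))) = (\<integral>y. f (x, y, ?u y) \<partial>Q x)" if x: "x \<in> X" for x
  proof -
    note Q' = prob_algebra_borel_onD[OF Q_space[OF x]]
    have "(\<lambda>y. return ?S (x, y, ?u y)) \<in> borel_on Y \<rightarrow>\<^sub>M prob_algebra ?S"
      using x by (intro measurable_compose[OF _ measurable_return_prob_space] measurable_Pair u)
        (auto simp: space_restrict_space)
    then have "(\<lambda>y. return ?S (x, y, ?u y)) \<in> Q x \<rightarrow>\<^sub>M prob_algebra ?S"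
      using measurable_cong_sets[OF Q'(2) refl] by blast
    from integral_bind_prob[OF f B this Q'(1)]
    have "(\<integral>z. f z \<partial>(Q x \<bind> (\<lambda>y. return ?S (x, y, ?u y)))) = (\<integral>y. (\<integral>z. f z \<partial>return ?S (x, y, ?u y)) \<partial>Q x)" .
    also have "\<dots> = (\<integral>y. f (x, y, ?u y) \<partial>Q x)"
      using x Q' ctrl_in_U[OF \<gamma> i]
      by (intro Bochner_Integration.integral_cong refl integral_return f)
        (auto simp: space_pair_measure space_restrict_space)
    finally show ?thesis .
  qed
  have "stage_kernel X Y U Q P T \<gamma> t h = next_state_law P t h \<bind> (\<lambda>x. Q x \<bind> (\<lambda>y. return ?S (x, y, ?u y)))"
    by (simp add: stage_kernel_def next_state_law_def ctrl_past_info)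
  also have "(\<integral>z. f z \<partial>\<dots>) = (\<integral>x. (\<integral>z. f z \<partial>(Q x \<bind> (\<lambda>y. return ?S (x, y, ?u y)))) \<partial>next_state_law P t h)"
    using K measurable_cong_sets[OF L(2) refl, of "prob_algebra ?S"] by (intro integral_bind_prob[OF f B _ L(1)]) auto
  also have "\<dots> = (\<integral>x. (\<integral>y. f (x, y, ?u y) \<partial>Q x) \<partial>next_state_law P t h)"
    using L by (intro Bochner_Integration.integral_cong refl inner) auto
  finally show ?thesis .
qed

lemma hist_space_Suc:
  "h \<in> space (hist_space t) \<Longrightarrow> z \<in> space (stage_space X Y U) \<Longrightarrow> h(t := z) \<in> space (hist_space (Suc t))"
  by (auto simp: space_PiM PiE_iff extensional_def)

lemma st_act_space: "z \<in> space (stage_space X Y U) \<Longrightarrow> (st z, act z) \<in> X \<times> U"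
  by (auto simp: space_pair_measure space_restrict_space st_def act_def)

lemma measurable_stage_cost[measurable]: "(\<lambda>z. c (st z, act z)) \<in> borel_measurable (stage_space X Y U)"
  by measurable

text \<open>The Bellman recursion seen from a history. Once \<open>(x, y, u)\<close> is appended,
  the next state has law \<open>T (x, u)\<close> and the past information is
  \<open>next_info\<close>, so the inner integrand is a \<open>stage_value\<close>.\<close>

lemma expected_cost_to_go_Suc:
  assumes P: "P \<in> space (prob_algebra (borel_on X))" and \<gamma>: "\<gamma> \<in> admissible Y U"
    and h: "h \<in> space (hist_space t)"
  shows "(\<integral>z. c (st z, act z) + \<beta> * expected_cost_to_go P \<gamma> k (Suc t) (h(t := z))
      \<partial>stage_kernel X Y U Q P T \<gamma> t h) = expected_cost_to_go P \<gamma> (Suc k) t h"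
proof -
  have upd: "(\<lambda>z. h(t := z)) \<in> stage_space X Y U \<rightarrow>\<^sub>M hist_space (Suc t)"
    using h by (intro measurable_fun_upd[where J="{0..<t}"]) auto
  note W = measurable_compose[OF upd measurable_expected_cost_to_go[OF P \<gamma>]]
  have "(\<integral>z. c (st z, act z) + \<beta> * expected_cost_to_go P \<gamma> k (Suc t) (h(t := z))
      \<partial>stage_kernel X Y U Q P T \<gamma> t h) =
    (\<integral>x. (\<integral>y. c (st (x, y, ctrl \<gamma> t (past_info t h) y), act (x, y, ctrl \<gamma> t (past_info t h) y)) +
       \<beta> * expected_cost_to_go P \<gamma> k (Suc t) (h(t := (x, y, ctrl \<gamma> t (past_info t h) y))) \<partial>Q x) \<partial>next_state_law P t h)"
  proof (rule integral_stage_kernel[OF P \<gamma> h])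
    show "(\<lambda>z. c (st z, act z) + \<beta> * expected_cost_to_go P \<gamma> k (Suc t) (h(t := z))) \<in> borel_measurable (stage_space X Y U)"
      using W by (intro borel_measurable_add borel_measurable_times measurable_stage_cost) auto
    show "\<bar>c (st z, act z) + \<beta> * expected_cost_to_go P \<gamma> k (Suc t) (h(t := z))\<bar> \<le> bound"
      if "z \<in> space (stage_space X Y U)" for z
      using that by (intro stage_sum_bound st_act_space expected_cost_to_go_bound[OF P \<gamma>] hist_space_Suc h)
  qed
  then show ?thesis
    by (simp add: expected_cost_to_go_def[of _ _ "Suc k"] stage_value_def st_def act_def
        expected_cost_to_go_def[of _ _ k] past_info_Suc next_state_law_def[of _ "Suc t"])
qed

section \<open>The discounted cost under the trajectory law\<close>

context
  fixes P \<gamma>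
  assumes P: "P \<in> space (prob_algebra (borel_on X))" and \<gamma>: "\<gamma> \<in> admissible Y U"
begin

interpretation IT: Ionescu_Tulcea "stage_kernel X Y U Q P T \<gamma>" "\<lambda>_. stage_space X Y U"
  by (rule Ionescu_Tulcea_stage_kernel[OF P T Q \<gamma>])

abbreviation "law \<equiv> trajectory_law X Y U Q P T \<gamma>"

lemma law_eq: "law = IT.PF.lim"
  by (simp add: trajectory_law_def)

lemma prob_space_law: "prob_space law"
  unfolding law_eq by (rule IT.prob_space_lim)

lemma sets_law: "sets law = sets (PiM UNIV (\<lambda>_. stage_space X Y U))"
  unfolding law_eq by simp

lemma space_law: "space law = space (PiM UNIV (\<lambda>_. stage_space X Y U))"
  unfolding law_eq by simp

lemma measurable_law_restrict: "(\<lambda>\<omega>. restrict \<omega> {0..<t}) \<in> law \<rightarrow>\<^sub>M hist_space t"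
  using measurable_cong_sets[OF sets_law refl] by (auto intro!: measurable_restrict_subset)

lemma measurable_law_cost: "(\<lambda>\<omega>. c (st (\<omega> t), act (\<omega> t))) \<in> borel_measurable law"
proof -
  have "(\<lambda>\<omega>. \<omega> t) \<in> law \<rightarrow>\<^sub>M stage_space X Y U"
    using measurable_cong_sets[OF sets_law refl] measurable_component_singleton[of t UNIV "\<lambda>_. stage_space X Y U"] by blast
  from measurable_compose[OF this measurable_stage_cost] show ?thesis .
qed

lemma law_cost_bounds:
  assumes "\<omega> \<in> space law"
  shows "0 \<le> c (st (\<omega> t), act (\<omega> t))" "c (st (\<omega> t), act (\<omega> t)) \<le> M"
proof -
  have "\<omega> t \<in> space (stage_space X Y U)" using assms by (auto simp: space_law space_PiM)
  from c_nonneg[OF st_act_space[OF this]] c_le[OF st_act_space[OF this]]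
  show "0 \<le> c (st (\<omega> t), act (\<omega> t))" "c (st (\<omega> t), act (\<omega> t)) \<le> M" .
qed

lemma integrable_law_cost: "integrable law (\<lambda>\<omega>. c (st (\<omega> t), act (\<omega> t)))"
  by (rule prob_space.integrable_bounded[OF prob_space_law measurable_law_cost, where B=M])
    (use law_cost_bounds in \<open>simp add: abs_of_nonneg\<close>)

text \<open>The recursion for a fixed history is averaged over histories;
  \<open>integral_lim_Suc\<close> absorbs the kernel of stage \<open>t\<close> into the law.\<close>

lemma expected_cost_to_go_law:
  "(\<integral>\<omega>. expected_cost_to_go P \<gamma> (Suc k) t (restrict \<omega> {0..<t}) \<partial>law) =
   (\<integral>\<omega>. c (st (\<omega> t), act (\<omega> t)) \<partial>law) +
     \<beta> * (\<integral>\<omega>. expected_cost_to_go P \<gamma> k (Suc t) (restrict \<omega> {0..<Suc t}) \<partial>law)"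
proof -
  define f where "f h = c (st (h t), act (h t)) + \<beta> * expected_cost_to_go P \<gamma> k (Suc t) h" for h
  have comp: "(\<lambda>h. h t) \<in> hist_space (Suc t) \<rightarrow>\<^sub>M stage_space X Y U"
    by (intro measurable_component_singleton) auto
  have f: "f \<in> borel_measurable (hist_space (Suc t))"
    unfolding f_def using measurable_compose[OF comp measurable_stage_cost]
    by (intro borel_measurable_add borel_measurable_times measurable_expected_cost_to_go P \<gamma>) auto
  have B: "\<bar>f h\<bar> \<le> bound" if h: "h \<in> space (hist_space (Suc t))" for h
    unfolding f_def
    by (intro stage_sum_bound st_act_space expected_cost_to_go_bound[OF P \<gamma> h] measurable_space[OF comp h])
  have W: "integrable law (\<lambda>\<omega>. expected_cost_to_go P \<gamma> k (Suc t) (restrict \<omega> {0..<Suc t}))"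
    by (rule prob_space.integrable_bounded[OF prob_space_law
          measurable_compose[OF measurable_law_restrict measurable_expected_cost_to_go[OF P \<gamma>]]])
      (rule expected_cost_to_go_bound[OF P \<gamma> measurable_space[OF measurable_law_restrict]])
  have "(\<integral>\<omega>. expected_cost_to_go P \<gamma> (Suc k) t (restrict \<omega> {0..<t}) \<partial>law) =
      (\<integral>\<omega>. (\<integral>z. f ((restrict \<omega> {0..<t})(t := z)) \<partial>stage_kernel X Y U Q P T \<gamma> t (restrict \<omega> {0..<t})) \<partial>law)"
    unfolding f_def using expected_cost_to_go_Suc[OF P \<gamma> measurable_space[OF measurable_law_restrict]]
    by (intro Bochner_Integration.integral_cong refl) simp
  also have "\<dots> = (\<integral>\<omega>. f (restrict \<omega> {0..<Suc t}) \<partial>law)"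
    using IT.integral_lim_Suc[OF f B] unfolding law_eq by simp
  also have "\<dots> = (\<integral>\<omega>. c (st (\<omega> t), act (\<omega> t)) \<partial>law) +
     \<beta> * (\<integral>\<omega>. expected_cost_to_go P \<gamma> k (Suc t) (restrict \<omega> {0..<Suc t}) \<partial>law)"
    unfolding f_def using integrable_law_cost[of t] W by simp
  finally show ?thesis .
qed

text \<open>Iterates the one-stage identity. The start time stays arbitrary in the induction, as
  each unfolding moves it on by one.\<close>

lemma expected_cost_to_go_sum:
  "(\<integral>\<omega>. expected_cost_to_go P \<gamma> N t (restrict \<omega> {0..<t}) \<partial>law) =
    (\<Sum>s<N. \<beta> ^ s * (\<integral>\<omega>. c (st (\<omega> (t + s)), act (\<omega> (t + s))) \<partial>law))"
proof (induction N arbitrary: t)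
  case (Suc N)
  show ?case
    unfolding expected_cost_to_go_law Suc.IH sum.lessThan_Suc_shift
    by (simp add: sum_distrib_left mult.assoc)
qed (simp add: expected_cost_to_go_def)

lemma finite_horizon_cost:
  "(\<integral>\<omega>. (\<Sum>t<N. \<beta> ^ t * c (st (\<omega> t), act (\<omega> t))) \<partial>law) =
    (\<integral>x. cost_to_go \<gamma> N 0 (\<lambda>_. undefined, \<lambda>_. undefined) x \<partial>P)"
proof -
  \<comment> \<open>Restriction to the empty index set forgets \<open>\<omega>\<close>: the
    integrand is constant, and at time 0 the state has law \<open>P\<close>.\<close>
  have "(\<integral>\<omega>. expected_cost_to_go P \<gamma> N 0 (restrict \<omega> {0..<0}) \<partial>law) =
      (\<integral>x. cost_to_go \<gamma> N 0 (\<lambda>_. undefined, \<lambda>_. undefined) x \<partial>P)"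
    using prob_space.prob_space[OF prob_space_law]
    by (simp add: expected_cost_to_go_def past_info_def next_state_law_def restrict_def)
  then show ?thesis
    using expected_cost_to_go_sum[of N 0] integrable_law_cost by (simp add: Bochner_Integration.integral_sum)
qed

text \<open>Comparison with the geometric series of terms
  \<open>\<beta> ^ N * M * \<beta> ^ t\<close>. The bound is the same for all trajectories, policies
  and priors.\<close>

lemma discounted_tail:
  assumes "\<omega> \<in> space law"
  shows "summable (\<lambda>t. \<beta> ^ t * c (st (\<omega> t), act (\<omega> t)))"
    and "0 \<le> (\<Sum>t. \<beta> ^ t * c (st (\<omega> t), act (\<omega> t))) - (\<Sum>t<N. \<beta> ^ t * c (st (\<omega> t), act (\<omega> t)))"
    and "(\<Sum>t. \<beta> ^ t * c (st (\<omega> t), act (\<omega> t))) - (\<Sum>t<N. \<beta> ^ t * c (st (\<omega> t), act (\<omega> t))) \<le> bound * \<beta> ^ N"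
proof -
  let ?c = "\<lambda>t. c (st (\<omega> t), act (\<omega> t))"
  note c = law_cost_bounds[OF assms]
  have geo: "(\<lambda>t. \<beta> ^ N * M * \<beta> ^ t) sums (\<beta> ^ N * M * (1 / (1 - \<beta>)))"
    using \<beta> by (intro sums_mult geometric_sums) auto
  show s: "summable (\<lambda>t. \<beta> ^ t * ?c t)"
  proof (rule summable_comparison_test')
    show "summable (\<lambda>t. \<beta> ^ t * M)" using \<beta> by (intro summable_mult2 summable_geometric) auto
    show "norm (\<beta> ^ t * ?c t) \<le> \<beta> ^ t * M" for t
      using \<beta> c[of t] by (simp add: abs_mult mult_left_mono)
  qed
  have s': "summable (\<lambda>t. \<beta> ^ (t + N) * ?c (t + N))" using s by (subst summable_iff_shift)
  have eq: "(\<Sum>t. \<beta> ^ t * ?c t) - (\<Sum>t<N. \<beta> ^ t * ?c t) = (\<Sum>t. \<beta> ^ (t + N) * ?c (t + N))"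
    using suminf_minus_initial_segment[OF s, of N] by simp
  show "0 \<le> (\<Sum>t. \<beta> ^ t * ?c t) - (\<Sum>t<N. \<beta> ^ t * ?c t)"
    unfolding eq using \<beta> c by (intro suminf_nonneg s') auto
  have "(\<Sum>t. \<beta> ^ (t + N) * ?c (t + N)) \<le> (\<Sum>t. \<beta> ^ N * M * \<beta> ^ t)"
    using \<beta> c(2) by (intro suminf_le s' sums_summable[OF geo]) (simp add: power_add mult_ac mult_left_mono)
  also have "\<dots> = bound * \<beta> ^ N" using sums_unique[OF geo, symmetric] by (simp add: mult.commute)
  finally show "(\<Sum>t. \<beta> ^ t * ?c t) - (\<Sum>t<N. \<beta> ^ t * ?c t) \<le> bound * \<beta> ^ N" unfolding eq .
qed

text \<open>Bounds the costs of all policies from below, for the real infimum in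
  \<open>opt_cost\<close>. It is the tail estimate with \<open>N = 0\<close>, whose partial sum is
  empty.\<close>

lemma cost_nonneg: "0 \<le> cost X Y U Q c \<beta> P T \<gamma>"
  unfolding cost_def using discounted_tail(2)[of _ 0] by (intro Bochner_Integration.integral_nonneg) simp

lemma cost_approx:
  "\<bar>cost X Y U Q c \<beta> P T \<gamma> - (\<integral>x. cost_to_go \<gamma> N 0 (\<lambda>_. undefined, \<lambda>_. undefined) x \<partial>P)\<bar> \<le> bound * \<beta> ^ N"
proof -
  let ?c = "\<lambda>\<omega> t. \<beta> ^ t * c (st (\<omega> t), act (\<omega> t))"
  have m: "(\<lambda>\<omega>. \<Sum>t. ?c \<omega> t) \<in> borel_measurable law" "(\<lambda>\<omega>. \<Sum>t<N. ?c \<omega> t) \<in> borel_measurable law"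
    using measurable_law_cost by (auto intro!: borel_measurable_suminf borel_measurable_sum borel_measurable_times)
  have i2: "integrable law (\<lambda>\<omega>. \<Sum>t<N. ?c \<omega> t)" using integrable_law_cost by auto
  have i1: "integrable law (\<lambda>\<omega>. \<Sum>t. ?c \<omega> t)"
    using discounted_tail(2,3)[of _ 0]
    by (intro prob_space.integrable_bounded[OF prob_space_law m(1), of bound]) simp
  have "\<bar>\<integral>\<omega>. (\<Sum>t. ?c \<omega> t) - (\<Sum>t<N. ?c \<omega> t) \<partial>law\<bar> \<le> bound * \<beta> ^ N"
    using discounted_tail(2,3)[of _ N] m
    by (intro prob_space.abs_integral_le_bound[OF prob_space_law] borel_measurable_diff) auto
  then show ?thesis
    using i1 i2 by (simp add: cost_def finite_horizon_cost)
qed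

end

subsection \<open>Uniform continuity in the prior\<close>

context
  assumes T_weak: "weakly_continuous_kernel (X \<times> U) X T"
    and Q_tv: "tv_continuous_kernel X Q"
    and U: "compact U"
begin

text \<open>Weak continuity of \<open>T\<close> gives weak convergence of the next-state laws, which
  equicontinuity of \<open>G\<close> makes uniform in \<open>g\<close>. The stage cost does not
  involve \<open>g\<close>.\<close>

lemma stage_value_joint:
  assumes G: "equicont_on X G" "\<And>g x. g \<in> G \<Longrightarrow> x \<in> X \<Longrightarrow> \<bar>g x\<bar> \<le> bound"
    and xs: "\<And>n. xs n \<in> X" "x \<in> X" "xs \<longlonglongrightarrow> x"
    and us: "\<And>n. us n \<in> U" "u \<in> U" "us \<longlonglongrightarrow> u" and e: "0 < e"
  shows "\<forall>\<^sub>F n in sequentially. \<forall>g\<in>G. \<bar>stage_value g (xs n) (us n) - stage_value g x u\<bar> \<le> e"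
proof -
  have lim: "(\<lambda>n. (xs n, us n)) \<longlonglongrightarrow> (x, u)" by (intro tendsto_Pair xs us)
  have comp: "(\<lambda>n. f (xs n, us n)) \<longlonglongrightarrow> f (x, u)" if "continuous_on (X \<times> U) f" for f :: "_ \<Rightarrow> real"
    by (rule continuous_on_tendsto_compose[OF that lim]) (use xs us in auto)
  have "weak_conv_on X (\<lambda>n. T (xs n, us n)) (T (x, u))"
    unfolding weak_conv_on_def
    using T_weak comp unfolding weakly_continuous_kernel_def by blast
  then have "\<forall>\<^sub>F n in sequentially. \<forall>g\<in>G. \<bar>(\<integral>x. g x \<partial>T (xs n, us n)) - (\<integral>x. g x \<partial>T (x, u))\<bar> \<le> e / 2"
    using e xs us by (intro weak_conv_on_uniform[OF G(1), where M=bound] G(2) T_space) auto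
  moreover have "\<forall>\<^sub>F n in sequentially. dist (c (xs n, us n)) (c (x, u)) < e / 2"
    using comp[OF c_cont] e by (intro tendstoD) auto
  ultimately show ?thesis
  proof eventually_elim
    case (elim n)
    show ?case
    proof
      fix g assume "g \<in> G"
      let ?d = "(\<integral>x. g x \<partial>T (xs n, us n)) - (\<integral>x. g x \<partial>T (x, u))"
      have "\<beta> * \<bar>?d\<bar> \<le> 1 * (e / 2)"
        using \<beta> elim(1) \<open>g \<in> G\<close> by (intro mult_mono) auto
      then have "\<bar>\<beta> * ?d\<bar> \<le> e / 2" using \<beta> by (simp add: abs_mult)
      moreover have "\<bar>c (xs n, us n) - c (x, u)\<bar> \<le> e / 2" using elim(2) by (simp add: dist_real_def)
      moreover have "stage_value g (xs n) (us n) - stage_value g x u = (c (xs n, us n) - c (x, u)) + \<beta> * ?d"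
        by (simp add: stage_value_def algebra_simps)
      ultimately show "\<bar>stage_value g (xs n) (us n) - stage_value g x u\<bar> \<le> e" by linarith
    qed
  qed
qed

text \<open>If uniformity in \<open>u\<close> fails, offending actions have a subsequence converging
  to some \<open>u\<close> in the compact set \<open>U\<close>. Paired with \<open>xs\<close> or
  with \<open>x\<close> they converge to the same \<open>(x, u)\<close>, against the joint
  statement.\<close>

lemma stage_value_uniform:
  assumes G: "equicont_on X G" "\<And>g x. g \<in> G \<Longrightarrow> x \<in> X \<Longrightarrow> \<bar>g x\<bar> \<le> bound"
    and xs: "\<And>n. xs n \<in> X" "x \<in> X" "xs \<longlonglongrightarrow> x" and e: "0 < e"
  shows "\<forall>\<^sub>F n in sequentially. \<forall>u\<in>U. \<forall>g\<in>G. \<bar>stage_value g (xs n) u - stage_value g x u\<bar> \<le> e"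
proof (rule ccontr)
  assume "\<not> ?thesis"
  from not_eventually_sequentiallyD[OF this] obtain r :: "nat \<Rightarrow> nat" where r: "strict_mono r"
    and "\<And>n. \<exists>u\<in>U. \<exists>g\<in>G. \<not> \<bar>stage_value g (xs (r n)) u - stage_value g x u\<bar> \<le> e"
    by auto
  then obtain us where us: "\<And>n. us n \<in> U"
    and bad: "\<And>n. \<exists>g\<in>G. \<not> \<bar>stage_value g (xs (r n)) (us n) - stage_value g x (us n)\<bar> \<le> e"
    by metis
  obtain u and s :: "nat \<Rightarrow> nat" where u: "u \<in> U" and s: "strict_mono s" and lim: "(us \<circ> s) \<longlonglongrightarrow> u"
    using U us unfolding compact_def by metis
  have "(xs \<circ> (r \<circ> s)) \<longlonglongrightarrow> x"
    by (intro LIMSEQ_subseq_LIMSEQ xs strict_mono_o r s)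
  then have "\<forall>\<^sub>F n in sequentially. \<forall>g\<in>G. \<bar>stage_value g (xs (r (s n))) (us (s n)) - stage_value g x u\<bar> \<le> e / 2"
    using lim e xs us u by (intro stage_value_joint[OF G(1)] G(2)) (auto simp: comp_def)
  \<comment> \<open>The same joint convergence, with the state constantly \<open>x\<close>.\<close>
  moreover have "\<forall>\<^sub>F n in sequentially. \<forall>g\<in>G. \<bar>stage_value g x (us (s n)) - stage_value g x u\<bar> \<le> e / 2"
    using lim e xs us u by (intro stage_value_joint[OF G(1)] G(2)) (auto simp: comp_def)
  ultimately have "\<forall>\<^sub>F n in sequentially. \<forall>g\<in>G. \<bar>stage_value g (xs (r (s n))) (us (s n)) - stage_value g x (us (s n))\<bar> \<le> e"
  proof eventually_elim
    case (elim n)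
    show ?case
    proof
      fix g assume "g \<in> G"
      with elim show "\<bar>stage_value g (xs (r (s n))) (us (s n)) - stage_value g x (us (s n))\<bar> \<le> e"
        using abs_triangle_ineq4[of "stage_value g (xs (r (s n))) (us (s n)) - stage_value g x u"
            "stage_value g x (us (s n)) - stage_value g x u"] by fastforce
    qed
  qed
  from eventually_happens[OF this] bad show False by auto
qed

text \<open>Times and information vary along with the policy, so that the family for
  \<open>k\<close> contains every continuation reached after the first of \<open>k + 1\<close>
  stages.\<close>

definition cost_to_go_family :: "nat \<Rightarrow> ('x \<Rightarrow> real) set" where
  "cost_to_go_family k = {cost_to_go \<gamma> k t i |\<gamma> t i. \<gamma> \<in> admissible Y U \<and> i \<in> space (info_space t)}"

lemma cost_to_go_family_bound: "g \<in> cost_to_go_family k \<Longrightarrow> x \<in> X \<Longrightarrow> \<bar>g x\<bar> \<le> bound"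
  unfolding cost_to_go_family_def using cost_to_go_bound by blast

lemma equicont_on_cost_to_go: "equicont_on X (cost_to_go_family k)"
proof (induction k)
  case 0
  show ?case by (auto simp: equicont_on_def cost_to_go_family_def intro: exI[of _ 1])
next
  case (Suc k)
  show ?case
  proof (rule equicont_on_sequentiallyI)
    fix xs x and e :: real
    assume xs: "\<And>n. xs n \<in> X" "x \<in> X" "xs \<longlonglongrightarrow> x" and e: "0 < e"
    have "\<forall>\<^sub>F n in sequentially. \<forall>u\<in>U. \<forall>g\<in>cost_to_go_family k. \<bar>stage_value g (xs n) u - stage_value g x u\<bar> \<le> e / 2"
      using e cost_to_go_family_bound by (intro stage_value_uniform Suc.IH xs) auto
    moreover have "(\<lambda>n. bound * tv_dist (Q (xs n)) (Q x)) \<longlonglongrightarrow> bound * 0"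
      using Q_tv xs unfolding tv_continuous_kernel_def by (intro tendsto_mult tendsto_const) blast
    then have "\<forall>\<^sub>F n in sequentially. bound * tv_dist (Q (xs n)) (Q x) < e / 2"
      using e by (intro order_tendstoD) auto
    ultimately show "\<forall>\<^sub>F n in sequentially. \<forall>g\<in>cost_to_go_family (Suc k). \<bar>g (xs n) - g x\<bar> \<le> e"
    proof eventually_elim
      case (elim n)
      show ?case
      proof
        fix g assume "g \<in> cost_to_go_family (Suc k)"
        then obtain \<gamma> t i where g: "g = cost_to_go \<gamma> (Suc k) t i"
          and \<gamma>: "\<gamma> \<in> admissible Y U" and i: "i \<in> space (info_space t)"
          by (auto simp: cost_to_go_family_def)
        \<comment> \<open>Separates the two roles of the state: \<open>z\<close> enters the stage
          value, while the law of \<open>y\<close> is chosen independently. The passage from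
          \<open>xs n\<close> to \<open>x\<close> changes first the measure, then the
          integrand.\<close>
        define \<phi> where "\<phi> z y = stage_value (cost_to_go \<gamma> k (Suc t) (next_info \<gamma> t i y)) z (ctrl \<gamma> t i y)" for z y
        note Q' = prob_algebra_borel_onD[OF Q_space]
        interpret Qx: prob_space "Q x" by (rule Q'(1)[OF xs(2)])
        have \<phi>_meas: "\<phi> z \<in> borel_measurable (Q w)" if "z \<in> X" "w \<in> X" for z w
          using measurable_stage_value2[OF \<gamma> i that(1), of k] measurable_cong_sets[OF Q'(2)[OF that(2)] refl]
          unfolding \<phi>_def[abs_def] by blast
        have \<phi>_bound: "\<bar>\<phi> z y\<bar> \<le> bound" if "z \<in> X" "y \<in> Y" for z y
          unfolding \<phi>_def using that
          by (intro stage_value_bound measurable_cost_to_go2[OF \<gamma>] cost_to_go_bound[OF \<gamma>] next_info_space ctrl_in_U \<gamma> i)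
        have \<phi>_int: "integrable (Q x) (\<phi> z)" if "z \<in> X" for z
          using that \<phi>_bound Q' xs by (intro Qx.integrable_bounded[of _ bound] \<phi>_meas) auto
        \<comment> \<open>The policy makes \<open>\<phi> (xs n)\<close> merely measurable in
          \<open>y\<close>, which total variation tolerates.\<close>
        have "\<bar>(\<integral>y. \<phi> (xs n) y \<partial>Q (xs n)) - (\<integral>y. \<phi> (xs n) y \<partial>Q x)\<bar> \<le> bound * tv_dist (Q (xs n)) (Q x)"
          using \<phi>_bound xs Q' bound_pos by (intro integral_diff_le_tv_dist \<phi>_meas) auto
        \<comment> \<open>For each \<open>y\<close> both terms share the action and the next
          information, so the bound uniform over \<open>U\<close> and the family applies
          pointwise.\<close>
        moreover have "\<bar>\<integral>y. \<phi> (xs n) y - \<phi> x y \<partial>Q x\<bar> \<le> e / 2"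
        proof (rule Qx.abs_integral_le_bound)
          show "(\<lambda>y. \<phi> (xs n) y - \<phi> x y) \<in> borel_measurable (Q x)"
            using xs by (intro borel_measurable_diff \<phi>_meas)
          fix y assume "y \<in> space (Q x)"
          then have y: "y \<in> Y" using Q' xs by simp
          have "cost_to_go \<gamma> k (Suc t) (next_info \<gamma> t i y) \<in> cost_to_go_family k"
            unfolding cost_to_go_family_def using next_info_space[OF \<gamma> i y] \<gamma> by blast
          then show "\<bar>\<phi> (xs n) y - \<phi> x y\<bar> \<le> e / 2"
            using elim(1) ctrl_in_U[OF \<gamma> i y] unfolding \<phi>_def by blast
        qed
        moreover have "(\<integral>y. \<phi> (xs n) y - \<phi> x y \<partial>Q x) = (\<integral>y. \<phi> (xs n) y \<partial>Q x) - (\<integral>y. \<phi> x y \<partial>Q x)"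
          by (intro Bochner_Integration.integral_diff \<phi>_int xs)
        ultimately show "\<bar>g (xs n) - g x\<bar> \<le> e"
          using elim(2) unfolding g cost_to_go.simps \<phi>_def[symmetric] by linarith
      qed
    qed
  qed
qed

lemma cost_uniform:
  assumes P: "P \<in> space (prob_algebra (borel_on X))" and Pn: "\<And>n. Pn n \<in> space (prob_algebra (borel_on X))"
    and conv: "weak_conv_on X Pn P" and e: "0 < e"
  shows "\<forall>\<^sub>F n in sequentially. \<forall>\<gamma>\<in>admissible Y U.
    \<bar>cost X Y U Q c \<beta> (Pn n) T \<gamma> - cost X Y U Q c \<beta> P T \<gamma>\<bar> \<le> e"
proof -
  \<comment> \<open>The horizon is fixed before \<open>n\<close> and the policy; two truncations and
    the change of prior take \<open>e / 3\<close> each.\<close>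
  have "(\<lambda>N. bound * \<beta> ^ N) \<longlonglongrightarrow> bound * 0"
    using \<beta> by (intro tendsto_mult tendsto_const LIMSEQ_realpow_zero) auto
  then have "\<forall>\<^sub>F N in sequentially. bound * \<beta> ^ N < e / 3"
    using e by (intro order_tendstoD) auto
  then obtain N where N: "bound * \<beta> ^ N < e / 3" by (auto dest: eventually_happens)
  let ?i = "(\<lambda>_. undefined, \<lambda>_. undefined) :: (nat \<Rightarrow> 'y) \<times> (nat \<Rightarrow> 'u)"
  \<comment> \<open>Over an empty index set the product space has one point, the constantly
    \<open>undefined\<close> function.\<close>
  have i: "?i \<in> space (info_space 0)" by (simp add: space_pair_measure space_PiM)
  have "\<forall>\<^sub>F n in sequentially. \<forall>g\<in>cost_to_go_family N. \<bar>(\<integral>x. g x \<partial>Pn n) - (\<integral>x. g x \<partial>P)\<bar> \<le> e / 3"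
    using e cost_to_go_family_bound
    by (intro weak_conv_on_uniform[OF equicont_on_cost_to_go _ Pn P conv, where M=bound]) auto
  then show ?thesis
  proof eventually_elim
    case (elim n)
    show ?case
    proof
      fix \<gamma> assume \<gamma>: "\<gamma> \<in> admissible Y U"
      then have "cost_to_go \<gamma> N 0 ?i \<in> cost_to_go_family N"
        unfolding cost_to_go_family_def using i by blast
      with elim have "\<bar>(\<integral>x. cost_to_go \<gamma> N 0 ?i x \<partial>Pn n) - (\<integral>x. cost_to_go \<gamma> N 0 ?i x \<partial>P)\<bar> \<le> e / 3" by blast
      then show "\<bar>cost X Y U Q c \<beta> (Pn n) T \<gamma> - cost X Y U Q c \<beta> P T \<gamma>\<bar> \<le> e"
        using cost_approx[OF Pn \<gamma>, of n N] cost_approx[OF P \<gamma>, of N] N by linarith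
    qed
  qed
qed

end

end

section \<open>Robustness of optimal policies under weak convergence of the priors\<close>

theorem theorem3p3:
  fixes X :: "'x::euclidean_space set"
    and Y :: "'y::euclidean_space set"
    and U :: "'u::euclidean_space set"
    and Q :: "'x \<Rightarrow> 'y measure"
    and T :: "'x \<times> 'u \<Rightarrow> 'x measure"
    and c :: "'x \<times> 'u \<Rightarrow> real"
    and \<beta> :: real
    and P :: "'x measure"
    and Pn :: "nat \<Rightarrow> 'x measure"
    and \<gamma>s :: "nat \<Rightarrow> ('y, 'u) policy"
  assumes "X \<in> sets borel" "Y \<in> sets borel" "U \<in> sets borel"
    and "Q \<in> borel_on X \<rightarrow>\<^sub>M prob_algebra (borel_on Y)"
    and "T \<in> borel_on X \<Otimes>\<^sub>M borel_on U \<rightarrow>\<^sub>M prob_algebra (borel_on X)"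
    and "0 < \<beta>" "\<beta> < 1"
    and "weakly_continuous_kernel (X \<times> U) X T"
    and "tv_continuous_kernel X Q"
    and "\<And>z. z \<in> X \<times> U \<Longrightarrow> 0 \<le> c z"
    and "bounded (c ` (X \<times> U))"
    and "continuous_on (X \<times> U) c"
    and "compact U"
    and "P \<in> space (prob_algebra (borel_on X))"
    and "\<And>n. Pn n \<in> space (prob_algebra (borel_on X))"
    and "weak_conv_on X Pn P"
    and "\<And>n. \<gamma>s n \<in> admissible Y U"
    and "\<And>n. cost X Y U Q c \<beta> (Pn n) T (\<gamma>s n) = opt_cost X Y U Q c \<beta> (Pn n) T"
  shows "(\<lambda>n. \<bar>cost X Y U Q c \<beta> P T (\<gamma>s n) - opt_cost X Y U Q c \<beta> P T\<bar>) \<longlonglongrightarrow> 0"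
proof -
  obtain M where M: "0 < M" "\<And>z. z \<in> X \<times> U \<Longrightarrow> c z \<le> M"
    using \<open>bounded (c ` (X \<times> U))\<close> unfolding bounded_pos by fastforce
  interpret pomdp X Y U Q T c \<beta> M
    by unfold_locales (use assms M in auto)
  let ?J = "\<lambda>P \<gamma>. cost X Y U Q c \<beta> P T \<gamma>" and ?opt = "\<lambda>P. opt_cost X Y U Q c \<beta> P T"
  have opt_le: "?opt P' \<le> ?J P' \<gamma>" if "P' \<in> space (prob_algebra (borel_on X))" "\<gamma> \<in> admissible Y U" for P' \<gamma>
    unfolding opt_cost_def using that cost_nonneg by (intro cINF_lower bdd_belowI2[where m=0]) auto
  show ?thesis
  proof (rule LIMSEQ_I)
    fix e :: real assume "0 < e"
    \<comment> \<open>The error \<open>e / 4\<close> is spent twice, on \<open>\<gamma>s n\<close>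
      and on its competitor; the total \<open>e / 2\<close> is strictly below
      \<open>e\<close>.\<close>
    then have "\<forall>\<^sub>F n in sequentially. \<forall>\<gamma>\<in>admissible Y U. \<bar>?J (Pn n) \<gamma> - ?J P \<gamma>\<bar> \<le> e / 4"
      using assms by (intro cost_uniform) auto
    then obtain N where N: "\<And>n \<gamma>. n \<ge> N \<Longrightarrow> \<gamma> \<in> admissible Y U \<Longrightarrow> \<bar>?J (Pn n) \<gamma> - ?J P \<gamma>\<bar> \<le> e / 4"
      unfolding eventually_sequentially by blast
    show "\<exists>N. \<forall>n\<ge>N. norm (\<bar>?J P (\<gamma>s n) - ?opt P\<bar> - 0) < e"
    proof (intro exI allI impI)
      fix n assume n: "N \<le> n"
      have "?J P (\<gamma>s n) - e / 2 \<le> ?opt P"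
        unfolding opt_cost_def[of _ _ _ _ _ _ P]
      proof (rule cINF_greatest)
        show "admissible Y U \<noteq> {}" using assms by blast
        fix \<gamma> assume \<gamma>: "\<gamma> \<in> admissible Y U"
        \<comment> \<open>Optimality holds under \<open>Pn n\<close>, and both costs are then moved
          to \<open>P\<close>. For \<open>\<gamma>s n\<close> this takes an estimate uniform in the
          policy, as the policy changes with \<open>n\<close>.\<close>
        have "?J (Pn n) (\<gamma>s n) \<le> ?J (Pn n) \<gamma>"
          using opt_le[of "Pn n" \<gamma>] \<gamma> assms by simp
        then show "?J P (\<gamma>s n) - e / 2 \<le> ?J P \<gamma>"
          using N[OF n \<gamma>] N[OF n assms(17)[of n]] by linarith
      qed
      moreover have "?opt P \<le> ?J P (\<gamma>s n)" using opt_le assms by blast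
      ultimately show "norm (\<bar>?J P (\<gamma>s n) - ?opt P\<bar> - 0) < e" using \<open>0 < e\<close> by simp
    qed
  qed
qed

end
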